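(* For any regular po-category $\mathbb{R}\cong\mathbb{R}\mathrm{el}_{\mathcal{R}}$, the po-functor $\mathrm{Sub}_{\mathcal{R}}=\mathbb{R}(I,-)\colon\mathbb{R}\to\mathbb{P}\mathrm{oset}$ is ajax.
   Context: A po-category is a category enriched in posets; po-functors are poset-enriched functors. A symmetric monoidal po-category is a po-category with po-functors $\otimes, I$ whose underlying 1-structures form a symmetric monoidal category. $\mathbb{P}\mathrm{oset}$ is the po-category of posets and monotone maps (pointwise order), with monoidal structure the cartesian product and unit the terminal poset $1$. In a po-category, $L\colon c\to d$ is left adjoint to $R\colon d\to c$ if $\mathrm{id}_c\le L;R$ and $R;L\le\mathrm{id}_d$, where $f;g$ means first $f$, then $g$. A po-functor $F\colon\mathbb{C}\to\mathbb{D}$ between symmetric monoidal po-categories is ajax (adjoint-lax) if it is lax symmetric monoidal (laxator naturality squares commute strictly) and its laxators $\rho\colon I\to F(I)$ and $\rho_{c,c'}\colon F(c)\otimes F(c')\to F(c\otimes c')$ are right adjoints in $\mathbb{D}$. For a regular category $\mathcal{R}$, $\mathbb{R}\mathrm{el}_{\mathcal{R}}$ is the po-category with the same objects, whose morphisms $r\to s$ are subobjects $x\subseteq r\times s$ ordered by inclusion, composed by pulling back over the middle object and taking the image in the product of the outer objects; it is symmetric monoidal with $r_1\otimes r_2=r_1\times r_2$ and unit $I$ the terminal object. A regular po-category is a po-category isomorphic to $\mathbb{R}\mathrm{el}_{\mathcal{R}}$ for some regular category $\mathcal{R}$. The po-functor $\mathbb{R}(I,-)$ sends $r$ to the poset of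 subobjects of $r$, and a relation $r\xleftarrow{f}A\xrightarrow{f'}r'$ to the map pulling a subobject back along $f$ and then taking its image along $f'$. Its canonical lax monoidal structure is given by $\mathrm{id}_I\in\mathbb{R}(I,I)$ and by $\otimes\colon\mathbb{R}(I,r_1)\times\mathbb{R}(I,r_2)\to\mathbb{R}(I,r_1\otimes r_2)$ (using $I\otimes I\cong I$). *)

theory Defs
  imports Main "HOL-Library.FuncSet"
begin

section \<open>Categories and po-categories\<close>

text \<open>Composition \<open>f \<Zsemi> g\<close> is written in diagrammatic order (first \<open>f\<close>, then \<open>g\<close>) and is
  meaningful only when the codomain of \<open>f\<close> is the domain of \<open>g\<close>.\<close>

record ('o, 'a) cat =
  Ob :: "'o set"
  Arr :: "'a set"
  Dom :: "'a \<Rightarrow> 'o"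
  Cod :: "'a \<Rightarrow> 'o"
  Id :: "'o \<Rightarrow> 'a"
  Comp :: "'a \<Rightarrow> 'a \<Rightarrow> 'a"  (infixl "\<Zsemi>\<index>" 60)

definition hom :: "('o, 'a, 'z) cat_scheme \<Rightarrow> 'o \<Rightarrow> 'o \<Rightarrow> 'a set" where
  "hom C a b = {f \<in> Arr C. Dom C f = a \<and> Cod C f = b}"

locale category =
  fixes C :: "('o, 'a, 'z) cat_scheme" (structure)
  assumes dom_ob: "f \<in> Arr C \<Longrightarrow> Dom C f \<in> Ob C"
    and cod_ob: "f \<in> Arr C \<Longrightarrow> Cod C f \<in> Ob C"
    and id_hom: "a \<in> Ob C \<Longrightarrow> Id C a \<in> hom C a a"
    and comp_hom: "f \<in> hom C a b \<Longrightarrow> g \<in> hom C b c \<Longrightarrow> f \<Zsemi> g \<in> hom C a c"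
    and id_left: "f \<in> hom C a b \<Longrightarrow> Id C a \<Zsemi> f = f"
    and id_right: "f \<in> hom C a b \<Longrightarrow> f \<Zsemi> Id C b = f"
    and comp_assoc: "f \<in> hom C a b \<Longrightarrow> g \<in> hom C b c \<Longrightarrow> h \<in> hom C c d \<Longrightarrow>
           (f \<Zsemi> g) \<Zsemi> h = f \<Zsemi> (g \<Zsemi> h)"

definition inverse_pair :: "('o, 'a, 'z) cat_scheme \<Rightarrow> 'a \<Rightarrow> 'a \<Rightarrow> bool" where
  "inverse_pair C f g \<longleftrightarrow> f \<in> Arr C \<and> g \<in> hom C (Cod C f) (Dom C f) \<and>
     f \<Zsemi>\<^bsub>C\<^esub> g = Id C (Dom C f) \<and> g \<Zsemi>\<^bsub>C\<^esub> f = Id C (Cod C f)"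

definition is_iso :: "('o, 'a, 'z) cat_scheme \<Rightarrow> 'a \<Rightarrow> bool" where
  "is_iso C f \<longleftrightarrow> (\<exists>g. inverse_pair C f g)"

definition inverse_arr :: "('o, 'a, 'z) cat_scheme \<Rightarrow> 'a \<Rightarrow> 'a" where
  "inverse_arr C f = (THE g. inverse_pair C f g)"

text \<open>\<open>Leq\<close> is only relevant on parallel arrows.\<close>

record ('o, 'a) pocat = "('o, 'a) cat" +
  Leq :: "'a \<Rightarrow> 'a \<Rightarrow> bool"  (infix "\<sqsubseteq>\<index>" 50)

locale po_category = category C for C :: "('o, 'a, 'z) pocat_scheme" (structure) +
  assumes leq_refl: "f \<in> hom C a b \<Longrightarrow> f \<sqsubseteq> f"
    and leq_trans: "f \<in> hom C a b \<Longrightarrow> g \<in> hom C a b \<Longrightarrow> h \<in> hom C a b \<Longrightarrow>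
           f \<sqsubseteq> g \<Longrightarrow> g \<sqsubseteq> h \<Longrightarrow> f \<sqsubseteq> h"
    and leq_antisym: "f \<in> hom C a b \<Longrightarrow> g \<in> hom C a b \<Longrightarrow> f \<sqsubseteq> g \<Longrightarrow> g \<sqsubseteq> f \<Longrightarrow> f = g"
    and comp_mono: "f \<in> hom C a b \<Longrightarrow> f' \<in> hom C a b \<Longrightarrow> g \<in> hom C b c \<Longrightarrow> g' \<in> hom C b c \<Longrightarrow>
           f \<sqsubseteq> f' \<Longrightarrow> g \<sqsubseteq> g' \<Longrightarrow> f \<Zsemi> g \<sqsubseteq> f' \<Zsemi> g'"

definition left_adjoint :: "('o, 'a, 'z) pocat_scheme \<Rightarrow> 'a \<Rightarrow> 'a \<Rightarrow> bool" where
  "left_adjoint C l r \<longleftrightarrow> l \<in> Arr C \<and> r \<in> hom C (Cod C l) (Dom C l) \<and>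
     Id C (Dom C l) \<sqsubseteq>\<^bsub>C\<^esub> l \<Zsemi>\<^bsub>C\<^esub> r \<and> r \<Zsemi>\<^bsub>C\<^esub> l \<sqsubseteq>\<^bsub>C\<^esub> Id C (Cod C l)"

definition is_right_adjoint :: "('o, 'a, 'z) pocat_scheme \<Rightarrow> 'a \<Rightarrow> bool" where
  "is_right_adjoint C r \<longleftrightarrow> (\<exists>l. left_adjoint C l r)"


section \<open>Symmetric monoidal po-categories\<close>

text \<open>\<open>\<odot>\<close> is the tensor on objects and \<open>\<otimes>\<close> the tensor on arrows.
  \<open>Assoc a b c : (a \<odot> b) \<odot> c \<rightarrow> a \<odot> (b \<odot> c)\<close>, \<open>LUnit a : I \<odot> a \<rightarrow> a\<close>,
  \<open>RUnit a : a \<odot> I \<rightarrow> a\<close>, \<open>Swap a b : a \<odot> b \<rightarrow> b \<odot> a\<close>.\<close>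

record ('o, 'a) smpocat = "('o, 'a) pocat" +
  TenO :: "'o \<Rightarrow> 'o \<Rightarrow> 'o"  (infixl "\<odot>\<index>" 70)
  TenA :: "'a \<Rightarrow> 'a \<Rightarrow> 'a"  (infixl "\<otimes>\<index>" 70)
  Unit :: "'o"
  Assoc :: "'o \<Rightarrow> 'o \<Rightarrow> 'o \<Rightarrow> 'a"
  LUnit :: "'o \<Rightarrow> 'a"
  RUnit :: "'o \<Rightarrow> 'a"
  Swap :: "'o \<Rightarrow> 'o \<Rightarrow> 'a"

locale sym_mon_pocat = po_category C for C :: "('o, 'a, 'z) smpocat_scheme" (structure) +
  assumes unit_ob: "Unit C \<in> Ob C"
    and ten_ob: "a \<in> Ob C \<Longrightarrow> b \<in> Ob C \<Longrightarrow> a \<odot> b \<in> Ob C"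
    and ten_hom: "f \<in> hom C a b \<Longrightarrow> g \<in> hom C c d \<Longrightarrow> f \<otimes> g \<in> hom C (a \<odot> c) (b \<odot> d)"
    and ten_id: "a \<in> Ob C \<Longrightarrow> b \<in> Ob C \<Longrightarrow> Id C a \<otimes> Id C b = Id C (a \<odot> b)"
    and ten_comp: "f \<in> hom C a b \<Longrightarrow> f' \<in> hom C b c \<Longrightarrow> g \<in> hom C d e \<Longrightarrow> g' \<in> hom C e k \<Longrightarrow>
           (f \<Zsemi> f') \<otimes> (g \<Zsemi> g') = (f \<otimes> g) \<Zsemi> (f' \<otimes> g')"
    and ten_mono: "f \<in> hom C a b \<Longrightarrow> f' \<in> hom C a b \<Longrightarrow> g \<in> hom C c d \<Longrightarrow> g' \<in> hom C c d \<Longrightarrow>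
           f \<sqsubseteq> f' \<Longrightarrow> g \<sqsubseteq> g' \<Longrightarrow> f \<otimes> g \<sqsubseteq> f' \<otimes> g'"
    and assoc_hom: "a \<in> Ob C \<Longrightarrow> b \<in> Ob C \<Longrightarrow> c \<in> Ob C \<Longrightarrow>
           Assoc C a b c \<in> hom C ((a \<odot> b) \<odot> c) (a \<odot> (b \<odot> c))"
    and lunit_hom: "a \<in> Ob C \<Longrightarrow> LUnit C a \<in> hom C (Unit C \<odot> a) a"
    and runit_hom: "a \<in> Ob C \<Longrightarrow> RUnit C a \<in> hom C (a \<odot> Unit C) a"
    and swap_hom: "a \<in> Ob C \<Longrightarrow> b \<in> Ob C \<Longrightarrow> Swap C a b \<in> hom C (a \<odot> b) (b \<odot> a)"
    and assoc_iso: "a \<in> Ob C \<Longrightarrow> b \<in> Ob C \<Longrightarrow> c \<in> Ob C \<Longrightarrow> is_iso C (Assoc C a b c)"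
    and lunit_iso: "a \<in> Ob C \<Longrightarrow> is_iso C (LUnit C a)"
    and runit_iso: "a \<in> Ob C \<Longrightarrow> is_iso C (RUnit C a)"
    and assoc_nat: "f \<in> hom C a a' \<Longrightarrow> g \<in> hom C b b' \<Longrightarrow> h \<in> hom C c c' \<Longrightarrow>
           ((f \<otimes> g) \<otimes> h) \<Zsemi> Assoc C a' b' c' = Assoc C a b c \<Zsemi> (f \<otimes> (g \<otimes> h))"
    and lunit_nat: "f \<in> hom C a b \<Longrightarrow> (Id C (Unit C) \<otimes> f) \<Zsemi> LUnit C b = LUnit C a \<Zsemi> f"
    and runit_nat: "f \<in> hom C a b \<Longrightarrow> (f \<otimes> Id C (Unit C)) \<Zsemi> RUnit C b = RUnit C a \<Zsemi> f"
    and swap_nat: "f \<in> hom C a a' \<Longrightarrow> g \<in> hom C b b' \<Longrightarrow>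
           (f \<otimes> g) \<Zsemi> Swap C a' b' = Swap C a b \<Zsemi> (g \<otimes> f)"
    and pentagon: "a \<in> Ob C \<Longrightarrow> b \<in> Ob C \<Longrightarrow> c \<in> Ob C \<Longrightarrow> d \<in> Ob C \<Longrightarrow>
           (Assoc C a b c \<otimes> Id C d) \<Zsemi> Assoc C a (b \<odot> c) d \<Zsemi> (Id C a \<otimes> Assoc C b c d)
             = Assoc C (a \<odot> b) c d \<Zsemi> Assoc C a b (c \<odot> d)"
    and triangle: "a \<in> Ob C \<Longrightarrow> b \<in> Ob C \<Longrightarrow>
           Assoc C a (Unit C) b \<Zsemi> (Id C a \<otimes> LUnit C b) = RUnit C a \<otimes> Id C b"
    and swap_swap: "a \<in> Ob C \<Longrightarrow> b \<in> Ob C \<Longrightarrow> Swap C a b \<Zsemi> Swap C b a = Id C (a \<odot> b)"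
    and hexagon: "a \<in> Ob C \<Longrightarrow> b \<in> Ob C \<Longrightarrow> c \<in> Ob C \<Longrightarrow>
           Assoc C a b c \<Zsemi> Swap C a (b \<odot> c) \<Zsemi> Assoc C b c a
             = (Swap C a b \<otimes> Id C c) \<Zsemi> Assoc C b a c \<Zsemi> (Id C b \<otimes> Swap C a c)"


section \<open>Po-functors, isomorphisms and ajax functors\<close>

record ('o, 'a, 'p, 'b) pofun =
  ObMap :: "'o \<Rightarrow> 'p"
  ArrMap :: "'a \<Rightarrow> 'b"

locale po_functor =
  fixes C :: "('o, 'a, 'z) pocat_scheme"
    and D :: "('p, 'b, 'y) pocat_scheme"
    and F :: "('o, 'a, 'p, 'b) pofun"
  assumes fun_ob: "a \<in> Ob C \<Longrightarrow> ObMap F a \<in> Ob D"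
    and fun_hom: "f \<in> hom C a b \<Longrightarrow> ArrMap F f \<in> hom D (ObMap F a) (ObMap F b)"
    and fun_id: "a \<in> Ob C \<Longrightarrow> ArrMap F (Id C a) = Id D (ObMap F a)"
    and fun_comp: "f \<in> hom C a b \<Longrightarrow> g \<in> hom C b c \<Longrightarrow>
           ArrMap F (f \<Zsemi>\<^bsub>C\<^esub> g) = ArrMap F f \<Zsemi>\<^bsub>D\<^esub> ArrMap F g"
    and fun_mono: "f \<in> hom C a b \<Longrightarrow> g \<in> hom C a b \<Longrightarrow> f \<sqsubseteq>\<^bsub>C\<^esub> g \<Longrightarrow> ArrMap F f \<sqsubseteq>\<^bsub>D\<^esub> ArrMap F g"

locale po_iso = po_functor C D F
  for C :: "('o, 'a, 'z) pocat_scheme" and D :: "('p, 'b, 'y) pocat_scheme"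
    and F :: "('o, 'a, 'p, 'b) pofun" +
  assumes ob_bij: "bij_betw (ObMap F) (Ob C) (Ob D)"
    and arr_bij: "bij_betw (ArrMap F) (Arr C) (Arr D)"
    and reflects_leq: "f \<in> hom C a b \<Longrightarrow> g \<in> hom C a b \<Longrightarrow> ArrMap F f \<sqsubseteq>\<^bsub>D\<^esub> ArrMap F g \<Longrightarrow> f \<sqsubseteq>\<^bsub>C\<^esub> g"

text \<open>An isomorphism of po-categories along which the monoidal structure of the domain is the
  one transported from the codomain. Every isomorphism of po-categories onto a symmetric monoidal
  po-category is of this form for exactly one monoidal structure on its domain.\<close>

locale sym_mon_po_iso = po_iso C D F
  for C :: "('o, 'a, 'z) smpocat_scheme" and D :: "('p, 'b, 'y) smpocat_scheme"
    and F :: "('o, 'a, 'p, 'b) pofun" +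
  assumes iso_unit: "ObMap F (Unit C) = Unit D"
    and iso_tenO: "a \<in> Ob C \<Longrightarrow> b \<in> Ob C \<Longrightarrow> ObMap F (a \<odot>\<^bsub>C\<^esub> b) = ObMap F a \<odot>\<^bsub>D\<^esub> ObMap F b"
    and iso_tenA: "f \<in> Arr C \<Longrightarrow> g \<in> Arr C \<Longrightarrow> ArrMap F (f \<otimes>\<^bsub>C\<^esub> g) = ArrMap F f \<otimes>\<^bsub>D\<^esub> ArrMap F g"
    and iso_assoc: "a \<in> Ob C \<Longrightarrow> b \<in> Ob C \<Longrightarrow> c \<in> Ob C \<Longrightarrow>
           ArrMap F (Assoc C a b c) = Assoc D (ObMap F a) (ObMap F b) (ObMap F c)"
    and iso_lunit: "a \<in> Ob C \<Longrightarrow> ArrMap F (LUnit C a) = LUnit D (ObMap F a)"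
    and iso_runit: "a \<in> Ob C \<Longrightarrow> ArrMap F (RUnit C a) = RUnit D (ObMap F a)"
    and iso_swap: "a \<in> Ob C \<Longrightarrow> b \<in> Ob C \<Longrightarrow>
           ArrMap F (Swap C a b) = Swap D (ObMap F a) (ObMap F b)"

text \<open>\<open>rho0 : I \<rightarrow> F I\<close> and \<open>rho a b : F a \<odot> F b \<rightarrow> F (a \<odot> b)\<close> are the laxators.\<close>

locale lax_sym_mon_pofunctor =
  src: sym_mon_pocat C + tgt: sym_mon_pocat D + po_functor C D F
  for C :: "('o, 'a, 'z) smpocat_scheme" and D :: "('p, 'b, 'y) smpocat_scheme"
    and F :: "('o, 'a, 'p, 'b) pofun" +
  fixes rho0 :: 'b and rho :: "'o \<Rightarrow> 'o \<Rightarrow> 'b"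
  assumes rho0_hom: "rho0 \<in> hom D (Unit D) (ObMap F (Unit C))"
    and rho_hom: "a \<in> Ob C \<Longrightarrow> b \<in> Ob C \<Longrightarrow>
           rho a b \<in> hom D (ObMap F a \<odot>\<^bsub>D\<^esub> ObMap F b) (ObMap F (a \<odot>\<^bsub>C\<^esub> b))"
    and rho_nat: "f \<in> hom C a a' \<Longrightarrow> g \<in> hom C b b' \<Longrightarrow>
           (ArrMap F f \<otimes>\<^bsub>D\<^esub> ArrMap F g) \<Zsemi>\<^bsub>D\<^esub> rho a' b' = rho a b \<Zsemi>\<^bsub>D\<^esub> ArrMap F (f \<otimes>\<^bsub>C\<^esub> g)"
    and rho_assoc: "a \<in> Ob C \<Longrightarrow> b \<in> Ob C \<Longrightarrow> c \<in> Ob C \<Longrightarrow>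
           (rho a b \<otimes>\<^bsub>D\<^esub> Id D (ObMap F c)) \<Zsemi>\<^bsub>D\<^esub> rho (a \<odot>\<^bsub>C\<^esub> b) c \<Zsemi>\<^bsub>D\<^esub> ArrMap F (Assoc C a b c)
             = Assoc D (ObMap F a) (ObMap F b) (ObMap F c)
                 \<Zsemi>\<^bsub>D\<^esub> (Id D (ObMap F a) \<otimes>\<^bsub>D\<^esub> rho b c) \<Zsemi>\<^bsub>D\<^esub> rho a (b \<odot>\<^bsub>C\<^esub> c)"
    and rho_lunit: "a \<in> Ob C \<Longrightarrow>
           (rho0 \<otimes>\<^bsub>D\<^esub> Id D (ObMap F a)) \<Zsemi>\<^bsub>D\<^esub> rho (Unit C) a \<Zsemi>\<^bsub>D\<^esub> ArrMap F (LUnit C a)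
             = LUnit D (ObMap F a)"
    and rho_runit: "a \<in> Ob C \<Longrightarrow>
           (Id D (ObMap F a) \<otimes>\<^bsub>D\<^esub> rho0) \<Zsemi>\<^bsub>D\<^esub> rho a (Unit C) \<Zsemi>\<^bsub>D\<^esub> ArrMap F (RUnit C a)
             = RUnit D (ObMap F a)"
    and rho_swap: "a \<in> Ob C \<Longrightarrow> b \<in> Ob C \<Longrightarrow>
           rho a b \<Zsemi>\<^bsub>D\<^esub> ArrMap F (Swap C a b) = Swap D (ObMap F a) (ObMap F b) \<Zsemi>\<^bsub>D\<^esub> rho b a"

locale ajax = lax_sym_mon_pofunctor C D F rho0 rho
  for C :: "('o, 'a, 'z) smpocat_scheme" and D :: "('p, 'b, 'y) smpocat_scheme"
    and F :: "('o, 'a, 'p, 'b) pofun" and rho0 :: 'b and rho :: "'o \<Rightarrow> 'o \<Rightarrow> 'b" +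
  assumes rho0_right_adjoint: "is_right_adjoint D rho0"
    and rho_right_adjoint: "a \<in> Ob C \<Longrightarrow> b \<in> Ob C \<Longrightarrow> is_right_adjoint D (rho a b)"


section \<open>The symmetric monoidal po-category of posets\<close>

text \<open>The elements of our posets live in the type \<open>'x elt\<close>, which contains the atoms from \<open>'x\<close>
  and is closed under pairing, so that the posets on subsets of this type are closed under
  cartesian products. An object is the order relation \<open>r\<close> itself; its carrier is \<open>Field r\<close>, because
  \<open>Partial_order r\<close> includes reflexivity on \<open>Field r\<close>. An arrow is a triple (domain, map, codomain),
  the map being \<open>undefined\<close> outside the carrier of the domain.\<close>

datatype 'x elt = Atom (unAtom: 'x) | Star | Couple (left: "'x elt") (right: "'x elt")

type_synonym 'x poset = "('x elt \<times> 'x elt) set"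
type_synonym 'x poset_arr = "'x poset \<times> ('x elt \<Rightarrow> 'x elt) \<times> 'x poset"

definition monotone_maps :: "'x poset \<Rightarrow> 'x poset \<Rightarrow> ('x elt \<Rightarrow> 'x elt) set" where
  "monotone_maps r s =
     {f \<in> Field r \<rightarrow>\<^sub>E Field s. \<forall>x y. (x, y) \<in> r \<longrightarrow> (f x, f y) \<in> s}"

definition poset_map :: "'x poset \<Rightarrow> ('x elt \<Rightarrow> 'x elt) \<Rightarrow> 'x poset \<Rightarrow> 'x poset_arr" where
  "poset_map r f s = (r, restrict f (Field r), s)"

definition prod_poset :: "'x poset \<Rightarrow> 'x poset \<Rightarrow> 'x poset" where
  "prod_poset r s = {(Couple x y, Couple x' y') | x y x' y'. (x, x') \<in> r \<and> (y, y') \<in> s}"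

definition unit_poset :: "'x poset" where
  "unit_poset = {(Star, Star)}"

definition Poset :: "('x poset, 'x poset_arr) smpocat" where
  "Poset = \<lparr>
     Ob = {r. Partial_order r},
     Arr = {(r, f, s). Partial_order r \<and> Partial_order s \<and> f \<in> monotone_maps r s},
     Dom = (\<lambda>(r, f, s). r),
     Cod = (\<lambda>(r, f, s). s),
     Id = (\<lambda>r. poset_map r (\<lambda>x. x) r),
     Comp = (\<lambda>(r, f, s) (s', g, t). poset_map r (\<lambda>x. g (f x)) t),
     Leq = (\<lambda>(r, f, s) (r', g, s'). \<forall>x \<in> Field r. (f x, g x) \<in> s),
     TenO = prod_poset,
     TenA = (\<lambda>(r, f, s) (r', g, s').
       poset_map (prod_poset r r') (\<lambda>z. Couple (f (left z)) (g (right z))) (prod_poset s s')),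
     Unit = unit_poset,
     Assoc = (\<lambda>r s t. poset_map (prod_poset (prod_poset r s) t)
       (\<lambda>z. Couple (left (left z)) (Couple (right (left z)) (right z))) (prod_poset r (prod_poset s t))),
     LUnit = (\<lambda>r. poset_map (prod_poset unit_poset r) right r),
     RUnit = (\<lambda>r. poset_map (prod_poset r unit_poset) left r),
     Swap = (\<lambda>r s. poset_map (prod_poset r s) (\<lambda>z. Couple (right z) (left z)) (prod_poset s r)) \<rparr>"


section \<open>Regular categories\<close>

definition is_mono :: "('o, 'a, 'z) cat_scheme \<Rightarrow> 'a \<Rightarrow> bool" where
  "is_mono C m \<longleftrightarrow> m \<in> Arr C \<and>
     (\<forall>x f g. f \<in> hom C x (Dom C m) \<and> g \<in> hom C x (Dom C m) \<and> f \<Zsemi>\<^bsub>C\<^esub> m = g \<Zsemi>\<^bsub>C\<^esub> m \<longrightarrow> f = g)"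

definition is_terminal :: "('o, 'a, 'z) cat_scheme \<Rightarrow> 'o \<Rightarrow> bool" where
  "is_terminal C t \<longleftrightarrow> t \<in> Ob C \<and> (\<forall>a \<in> Ob C. \<exists>!f. f \<in> hom C a t)"

definition is_product :: "('o, 'a, 'z) cat_scheme \<Rightarrow> 'o \<Rightarrow> 'o \<Rightarrow> 'o \<Rightarrow> 'a \<Rightarrow> 'a \<Rightarrow> bool" where
  "is_product C a b p p1 p2 \<longleftrightarrow> p1 \<in> hom C p a \<and> p2 \<in> hom C p b \<and>
     (\<forall>x f g. f \<in> hom C x a \<and> g \<in> hom C x b \<longrightarrow>
        (\<exists>!h. h \<in> hom C x p \<and> h \<Zsemi>\<^bsub>C\<^esub> p1 = f \<and> h \<Zsemi>\<^bsub>C\<^esub> p2 = g))"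

text \<open>\<open>p\<close> and \<open>q\<close> are the legs of a pullback of the cospan \<open>f\<close>, \<open>g\<close>, over \<open>f\<close> and \<open>g\<close> respectively.\<close>

definition is_pullback :: "('o, 'a, 'z) cat_scheme \<Rightarrow> 'a \<Rightarrow> 'a \<Rightarrow> 'a \<Rightarrow> 'a \<Rightarrow> bool" where
  "is_pullback C p q f g \<longleftrightarrow> f \<in> Arr C \<and> g \<in> Arr C \<and> Cod C f = Cod C g \<and>
     p \<in> hom C (Dom C p) (Dom C f) \<and> q \<in> hom C (Dom C p) (Dom C g) \<and> p \<Zsemi>\<^bsub>C\<^esub> f = q \<Zsemi>\<^bsub>C\<^esub> g \<and>
     (\<forall>x h k. h \<in> hom C x (Dom C f) \<and> k \<in> hom C x (Dom C g) \<and> h \<Zsemi>\<^bsub>C\<^esub> f = k \<Zsemi>\<^bsub>C\<^esub> g \<longrightarrow>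
        (\<exists>!u. u \<in> hom C x (Dom C p) \<and> u \<Zsemi>\<^bsub>C\<^esub> p = h \<and> u \<Zsemi>\<^bsub>C\<^esub> q = k))"

definition is_coequalizer :: "('o, 'a, 'z) cat_scheme \<Rightarrow> 'a \<Rightarrow> 'a \<Rightarrow> 'a \<Rightarrow> bool" where
  "is_coequalizer C e f g \<longleftrightarrow> f \<in> Arr C \<and> g \<in> hom C (Dom C f) (Cod C f) \<and>
     e \<in> hom C (Cod C f) (Cod C e) \<and> f \<Zsemi>\<^bsub>C\<^esub> e = g \<Zsemi>\<^bsub>C\<^esub> e \<and>
     (\<forall>x h. h \<in> hom C (Cod C f) x \<and> f \<Zsemi>\<^bsub>C\<^esub> h = g \<Zsemi>\<^bsub>C\<^esub> h \<longrightarrow>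
        (\<exists>!u. u \<in> hom C (Cod C e) x \<and> e \<Zsemi>\<^bsub>C\<^esub> u = h))"

definition is_regular_epi :: "('o, 'a, 'z) cat_scheme \<Rightarrow> 'a \<Rightarrow> bool" where
  "is_regular_epi C e \<longleftrightarrow> (\<exists>f g. is_coequalizer C e f g)"

text \<open>Finite completeness is expressed by a terminal object and pullbacks.\<close>

locale regular_category = category C for C :: "('o, 'a, 'z) cat_scheme" (structure) +
  assumes has_terminal: "\<exists>t. is_terminal C t"
    and has_pullbacks: "f \<in> Arr C \<Longrightarrow> g \<in> Arr C \<Longrightarrow> Cod C f = Cod C g \<Longrightarrow>
           \<exists>p q. is_pullback C p q f g"
    and kernel_pair_coequalizer: "is_pullback C p q f f \<Longrightarrow> \<exists>e. is_coequalizer C e p q"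
    and regular_epi_stable: "is_regular_epi C e \<Longrightarrow> is_pullback C p q f e \<Longrightarrow> is_regular_epi C p"

text \<open>The choice of finite products that is used to make \<open>r \<times> s\<close> a function of \<open>r\<close> and \<open>s\<close>.\<close>

record ('o, 'a) fpcat = "('o, 'a) cat" +
  One :: "'o"
  Prod :: "'o \<Rightarrow> 'o \<Rightarrow> 'o"  (infixl "\<boxtimes>\<index>" 70)
  Pr1 :: "'o \<Rightarrow> 'o \<Rightarrow> 'a"
  Pr2 :: "'o \<Rightarrow> 'o \<Rightarrow> 'a"

locale regular_category_chosen_products =
  regular_category C for C :: "('o, 'a, 'z) fpcat_scheme" (structure) +
  assumes one_terminal: "is_terminal C (One C)"
    and prod_product: "a \<in> Ob C \<Longrightarrow> b \<in> Ob C \<Longrightarrow>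
           is_product C a b (a \<boxtimes> b) (Pr1 C a b) (Pr2 C a b)"

definition tuple :: "('o, 'a, 'z) fpcat_scheme \<Rightarrow> 'a \<Rightarrow> 'a \<Rightarrow> 'a" where
  "tuple C f g = (THE h. h \<in> hom C (Dom C f) (Cod C f \<boxtimes>\<^bsub>C\<^esub> Cod C g) \<and>
     h \<Zsemi>\<^bsub>C\<^esub> Pr1 C (Cod C f) (Cod C g) = f \<and> h \<Zsemi>\<^bsub>C\<^esub> Pr2 C (Cod C f) (Cod C g) = g)"


section \<open>Subobjects\<close>

text \<open>A subobject of \<open>a\<close> is an isomorphism class of monomorphisms into \<open>a\<close>.\<close>

definition sub_class :: "('o, 'a, 'z) cat_scheme \<Rightarrow> 'a \<Rightarrow> 'a set" where
  "sub_class C m = {m'. is_mono C m' \<and> Cod C m' = Cod C m \<and>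
     (\<exists>i \<in> hom C (Dom C m') (Dom C m). is_iso C i \<and> i \<Zsemi>\<^bsub>C\<^esub> m = m')}"

definition Sub :: "('o, 'a, 'z) cat_scheme \<Rightarrow> 'o \<Rightarrow> 'a set set" where
  "Sub C a = {sub_class C m | m. is_mono C m \<and> Cod C m = a}"

definition sub_le :: "('o, 'a, 'z) cat_scheme \<Rightarrow> 'a set \<Rightarrow> 'a set \<Rightarrow> bool" where
  "sub_le C S T \<longleftrightarrow>
     (\<exists>m \<in> S. \<exists>n \<in> T. \<exists>h \<in> hom C (Dom C m) (Dom C n). h \<Zsemi>\<^bsub>C\<^esub> n = m)"

text \<open>The image of \<open>f\<close>, as a subobject of its codomain: all \<open>m\<close> occurring in a factorization of
  \<open>f\<close> as a regular epimorphism followed by a monomorphism \<open>m\<close>. In a regular category such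
  factorizations exist and are unique up to isomorphism, so this is a single isomorphism class.\<close>

definition image_sub :: "('o, 'a, 'z) cat_scheme \<Rightarrow> 'a \<Rightarrow> 'a set" where
  "image_sub C f = {m. is_mono C m \<and>
     (\<exists>e. is_regular_epi C e \<and> e \<in> hom C (Dom C f) (Dom C m) \<and> e \<Zsemi>\<^bsub>C\<^esub> m = f)}"


section \<open>The po-category of relations\<close>

text \<open>A relation from \<open>r\<close> to \<open>s\<close> is a triple \<open>(r, S, s)\<close> with \<open>S\<close> a subobject of \<open>r \<times> s\<close>. The unions
  below range over all choices of representing monomorphisms and pullbacks; the united sets do not
  depend on these choices.\<close>

type_synonym ('o, 'a) rel_arr = "'o \<times> 'a set \<times> 'o"

definition rel_comp :: "('o, 'a, 'z) fpcat_scheme \<Rightarrow>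
    ('o, 'a) rel_arr \<Rightarrow> ('o, 'a) rel_arr \<Rightarrow> ('o, 'a) rel_arr" where
  "rel_comp C = (\<lambda>(r, S, s) (s', T, t).
     (r, \<Union>{image_sub C (tuple C (p \<Zsemi>\<^bsub>C\<^esub> (m \<Zsemi>\<^bsub>C\<^esub> Pr1 C r s)) (q \<Zsemi>\<^bsub>C\<^esub> (n \<Zsemi>\<^bsub>C\<^esub> Pr2 C s t))) | m n p q.
            m \<in> S \<and> n \<in> T \<and> is_pullback C p q (m \<Zsemi>\<^bsub>C\<^esub> Pr2 C r s) (n \<Zsemi>\<^bsub>C\<^esub> Pr1 C s t)}, t))"

text \<open>The product of \<open>m : A \<rightarrow> r1 \<times> s1\<close> and \<open>n : B \<rightarrow> r2 \<times> s2\<close>, as a map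
  \<open>A \<times> B \<rightarrow> (r1 \<times> r2) \<times> (s1 \<times> s2)\<close>.\<close>

definition rel_ten_map :: "('o, 'a, 'z) fpcat_scheme \<Rightarrow>
    'o \<Rightarrow> 'o \<Rightarrow> 'a \<Rightarrow> 'o \<Rightarrow> 'o \<Rightarrow> 'a \<Rightarrow> 'a" where
  "rel_ten_map C r1 s1 m r2 s2 n =
     (let p = Pr1 C (Dom C m) (Dom C n); q = Pr2 C (Dom C m) (Dom C n) in
      tuple C
        (tuple C (p \<Zsemi>\<^bsub>C\<^esub> (m \<Zsemi>\<^bsub>C\<^esub> Pr1 C r1 s1)) (q \<Zsemi>\<^bsub>C\<^esub> (n \<Zsemi>\<^bsub>C\<^esub> Pr1 C r2 s2)))
        (tuple C (p \<Zsemi>\<^bsub>C\<^esub> (m \<Zsemi>\<^bsub>C\<^esub> Pr2 C r1 s1)) (q \<Zsemi>\<^bsub>C\<^esub> (n \<Zsemi>\<^bsub>C\<^esub> Pr2 C r2 s2))))"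

definition rel_ten :: "('o, 'a, 'z) fpcat_scheme \<Rightarrow>
    ('o, 'a) rel_arr \<Rightarrow> ('o, 'a) rel_arr \<Rightarrow> ('o, 'a) rel_arr" where
  "rel_ten C = (\<lambda>(r1, S, s1) (r2, T, s2).
     (r1 \<boxtimes>\<^bsub>C\<^esub> r2, \<Union>{sub_class C (rel_ten_map C r1 s1 m r2 s2 n) | m n. m \<in> S \<and> n \<in> T}, s1 \<boxtimes>\<^bsub>C\<^esub> s2))"

definition graph :: "('o, 'a, 'z) fpcat_scheme \<Rightarrow> 'a \<Rightarrow> ('o, 'a) rel_arr" where
  "graph C f = (Dom C f, sub_class C (tuple C (Id C (Dom C f)) f), Cod C f)"

definition Rel :: "('o, 'a, 'z) fpcat_scheme \<Rightarrow> ('o, ('o, 'a) rel_arr) smpocat" where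
  "Rel C = \<lparr>
     Ob = Ob C,
     Arr = {(r, S, s). r \<in> Ob C \<and> s \<in> Ob C \<and> S \<in> Sub C (r \<boxtimes>\<^bsub>C\<^esub> s)},
     Dom = (\<lambda>(r, S, s). r),
     Cod = (\<lambda>(r, S, s). s),
     Id = (\<lambda>r. graph C (Id C r)),
     Comp = rel_comp C,
     Leq = (\<lambda>(r, S, s) (r', T, s'). sub_le C S T),
     TenO = (\<lambda>r s. r \<boxtimes>\<^bsub>C\<^esub> s),
     TenA = rel_ten C,
     Unit = One C,
     Assoc = (\<lambda>a b c. graph C
       (tuple C (Pr1 C (a \<boxtimes>\<^bsub>C\<^esub> b) c \<Zsemi>\<^bsub>C\<^esub> Pr1 C a b)
                (tuple C (Pr1 C (a \<boxtimes>\<^bsub>C\<^esub> b) c \<Zsemi>\<^bsub>C\<^esub> Pr2 C a b) (Pr2 C (a \<boxtimes>\<^bsub>C\<^esub> b) c)))),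
     LUnit = (\<lambda>a. graph C (Pr2 C (One C) a)),
     RUnit = (\<lambda>a. graph C (Pr1 C a (One C))),
     Swap = (\<lambda>a b. graph C (tuple C (Pr2 C a b) (Pr1 C a b))) \<rparr>"


section \<open>The functor represented by the unit, and the subobject functor\<close>

definition hom_poset :: "('o, 'a, 'z) smpocat_scheme \<Rightarrow> 'o \<Rightarrow> 'a poset" where
  "hom_poset R r = {(Atom x, Atom y) | x y.
     x \<in> hom R (Unit R) r \<and> y \<in> hom R (Unit R) r \<and> x \<sqsubseteq>\<^bsub>R\<^esub> y}"

definition hom_unit :: "('o, 'a, 'z) smpocat_scheme \<Rightarrow> ('o, 'a, 'a poset, 'a poset_arr) pofun" where
  "hom_unit R = \<lparr>
     ObMap = hom_poset R,
     ArrMap = (\<lambda>f. poset_map (hom_poset R (Dom R f))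
       (\<lambda>x. Atom (unAtom x \<Zsemi>\<^bsub>R\<^esub> f)) (hom_poset R (Cod R f))) \<rparr>"

definition hom_unit_laxator0 :: "('o, 'a, 'z) smpocat_scheme \<Rightarrow> 'a poset_arr" where
  "hom_unit_laxator0 R =
     poset_map unit_poset (\<lambda>_. Atom (Id R (Unit R))) (hom_poset R (Unit R))"

definition hom_unit_laxator :: "('o, 'a, 'z) smpocat_scheme \<Rightarrow> 'o \<Rightarrow> 'o \<Rightarrow> 'a poset_arr" where
  "hom_unit_laxator R r s =
     poset_map (prod_poset (hom_poset R r) (hom_poset R s))
       (\<lambda>z. Atom (inverse_arr R (LUnit R (Unit R)) \<Zsemi>\<^bsub>R\<^esub> (unAtom (left z) \<otimes>\<^bsub>R\<^esub> unAtom (right z))))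
       (hom_poset R (r \<odot>\<^bsub>R\<^esub> s))"

text \<open>The action of a relation \<open>(r, X, s)\<close>, represented by \<open>x : A \<rightarrow> r \<times> s\<close>, on a subobject of \<open>r\<close>:
  pull back along the first leg of \<open>x\<close>, then take the image along the second.\<close>

definition sub_push :: "('o, 'a, 'z) fpcat_scheme \<Rightarrow> ('o, 'a) rel_arr \<Rightarrow> 'a set \<Rightarrow> 'a set" where
  "sub_push C = (\<lambda>(r, X, s) S.
     \<Union>{image_sub C (q \<Zsemi>\<^bsub>C\<^esub> (x \<Zsemi>\<^bsub>C\<^esub> Pr2 C r s)) | m x p q.
        m \<in> S \<and> x \<in> X \<and> is_pullback C p q m (x \<Zsemi>\<^bsub>C\<^esub> Pr1 C r s)})"

text \<open>A relation from the terminal object to \<open>r\<close>, i.e. a subobject of \<open>1 \<times> r\<close>, regarded as a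
  subobject of \<open>r\<close> along the isomorphism \<open>1 \<times> r \<cong> r\<close>.\<close>

definition rel_to_sub :: "('o, 'a, 'z) fpcat_scheme \<Rightarrow> ('o, 'a) rel_arr \<Rightarrow> 'a set" where
  "rel_to_sub C = (\<lambda>(u, S, r). {k \<Zsemi>\<^bsub>C\<^esub> Pr2 C u r | k. k \<in> S})"

text \<open>The identification \<open>R(I, -) = Sub\<close>: an isomorphism of posets \<open>R(I, r) \<cong> Sub (\<Phi> r)\<close> for each
  object \<open>r\<close>, carrying the action of a morphism \<open>f\<close> of \<open>R\<close> to the action of the relation \<open>\<Phi> f\<close>.\<close>

definition hom_unit_is_Sub :: "('o, 'a, 'z) fpcat_scheme \<Rightarrow> ('p, 'b, 'y) smpocat_scheme \<Rightarrow>
    ('p, 'b, 'o, ('o, 'a) rel_arr) pofun \<Rightarrow> bool" where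
  "hom_unit_is_Sub C R \<Phi> \<longleftrightarrow>
     (\<forall>r \<in> Ob R.
        bij_betw (\<lambda>x. rel_to_sub C (ArrMap \<Phi> x)) (hom R (Unit R) r) (Sub C (ObMap \<Phi> r)) \<and>
        (\<forall>x \<in> hom R (Unit R) r. \<forall>y \<in> hom R (Unit R) r.
           x \<sqsubseteq>\<^bsub>R\<^esub> y \<longleftrightarrow> sub_le C (rel_to_sub C (ArrMap \<Phi> x)) (rel_to_sub C (ArrMap \<Phi> y)))) \<and>
     (\<forall>r s f x. f \<in> hom R r s \<and> x \<in> hom R (Unit R) r \<longrightarrow>
        rel_to_sub C (ArrMap \<Phi> (x \<Zsemi>\<^bsub>R\<^esub> f)) = sub_push C (ArrMap \<Phi> f) (rel_to_sub C (ArrMap \<Phi> x)))"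

end

theory Submission
  imports Defs
begin

text \<open>
  Write \<open>x \<cdot> y = \<lambda>\<^sup>-\<^sup>1 \<Zsemi> (x \<otimes> y)\<close> for the laxator of \<open>R(I, -)\<close>. Its coherence laws hold in any symmetric
  monoidal category once \<open>\<lambda>\<close> and \<open>\<rho>\<close> agree at \<open>I\<close> and the symmetry of \<open>I \<otimes> I\<close> is the identity; for
  relations both are clear, because \<open>1 \<times> 1\<close> is terminal. For the same reason \<open>id\<close> is the top element of
  \<open>R(I, I)\<close>, so \<open>id : 1 \<rightarrow> R(I, I)\<close> is a right adjoint. The left adjoint of the other laxator sends \<open>z\<close> to
  its two projections \<open>(z \<Zsemi> p, z \<Zsemi> q)\<close>, with \<open>p = (id \<otimes> \<epsilon>) \<Zsemi> \<rho>\<close> and \<open>q = (\<epsilon> \<otimes> id) \<Zsemi> \<lambda>\<close>, where \<open>\<epsilon>\<close> is the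
  graph of the map to the terminal object. The inequality \<open>(x \<cdot> y) \<Zsemi> p \<le> x\<close> follows from \<open>y \<Zsemi> \<epsilon> \<le> id\<close>,
  and \<open>z \<le> (z \<Zsemi> p) \<cdot> (z \<Zsemi> q)\<close> is checked on generalized elements. The identification of \<open>R(I, r)\<close>
  with \<open>Sub r\<close> is composition with the isomorphism \<open>1 \<times> r \<cong> r\<close>.
\<close>

section \<open>Maps of posets\<close>

text \<open>Extensionality, which \<open>monotone_maps\<close> demands, is left out because
  \<open>poset_map\<close> restricts its function anyway. Arrows of \<open>Poset\<close> can thus be
  given by plain lambda terms.\<close>

definition poset_hom :: "'x poset \<Rightarrow> 'x poset \<Rightarrow> ('x elt \<Rightarrow> 'x elt) \<Rightarrow> bool" where
  "poset_hom r s f \<longleftrightarrow> (\<forall>x y. (x, y) \<in> r \<longrightarrow> (f x, f y) \<in> s)"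

lemma Partial_order_refl: "Partial_order r \<Longrightarrow> x \<in> Field r \<longleftrightarrow> (x, x) \<in> r"
  by (auto simp: partial_order_on_def preorder_on_def refl_on_def Field_def)

lemma Partial_order_trans: "Partial_order r \<Longrightarrow> (x, y) \<in> r \<Longrightarrow> (y, z) \<in> r \<Longrightarrow> (x, z) \<in> r"
  by (auto simp: partial_order_on_def preorder_on_def dest: transD)

lemma Partial_order_antisym: "Partial_order r \<Longrightarrow> (x, y) \<in> r \<Longrightarrow> (y, x) \<in> r \<Longrightarrow> x = y"
  by (auto simp: partial_order_on_def dest: antisymD)

text \<open>In a partial order, membership in the carrier is the reflexive pair, and monotone
  functions preserve that pair. Preservation of carriers therefore need not be part of
  \<open>poset_hom\<close>.\<close>

lemma poset_hom_Field: "poset_hom r s f \<Longrightarrow> Partial_order r \<Longrightarrow> x \<in> Field r \<Longrightarrow> f x \<in> Field s"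
  by (auto simp: Partial_order_refl poset_hom_def intro: FieldI1)

lemma Poset_simps [simp]:
  "Ob Poset = {r. Partial_order r}"
  "Id Poset r = poset_map r (\<lambda>x. x) r"
  "TenO Poset = prod_poset"
  "Unit Poset = unit_poset"
  "Assoc Poset r s t = poset_map (prod_poset (prod_poset r s) t)
     (\<lambda>z. Couple (left (left z)) (Couple (right (left z)) (right z))) (prod_poset r (prod_poset s t))"
  "LUnit Poset r = poset_map (prod_poset unit_poset r) right r"
  "RUnit Poset r = poset_map (prod_poset r unit_poset) left r"
  "Swap Poset r s = poset_map (prod_poset r s) (\<lambda>z. Couple (right z) (left z)) (prod_poset s r)"
  "Dom Poset (poset_map r f s) = r"
  "Cod Poset (poset_map r f s) = s"
  by (simp_all add: Poset_def poset_map_def)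

lemma poset_map_eq_iff: "poset_map r f s = poset_map r g s \<longleftrightarrow> (\<forall>x\<in>Field r. f x = g x)"
  by (auto simp: poset_map_def restrict_def fun_eq_iff)

lemma poset_map_hom:
  assumes "Partial_order r" "Partial_order s" "poset_hom r s f"
  shows "poset_map r f s \<in> hom Poset r s"
  using assms poset_hom_Field[OF assms(3,1)] FieldI1 FieldI2
  by (fastforce simp: hom_def Poset_def poset_map_def monotone_maps_def poset_hom_def)

text \<open>An extensional function is its own restriction. This brings every arrow into the form
  \<open>poset_map r f s\<close>, on which all later calculations rest.\<close>

lemma hom_PosetE:
  assumes "p \<in> hom Poset r s"
  obtains f where "p = poset_map r f s" "poset_hom r s f" "Partial_order r" "Partial_order s"
proof -
  from assms obtain f where p: "p = (r, f, s)" "Partial_order r" "Partial_order s"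
    and f: "f \<in> monotone_maps r s"
    by (auto simp: hom_def Poset_def)
  then have "p = poset_map r f s"
    by (auto simp: poset_map_def monotone_maps_def PiE_restrict)
  moreover have "poset_hom r s f" using f by (simp add: poset_hom_def monotone_maps_def)
  ultimately show thesis using p(2,3) by (rule that)
qed

text \<open>Values of \<open>f\<close> stay in the carrier of \<open>s\<close>, so the restriction
  built into the second arrow has no effect on them.\<close>

lemma poset_map_comp:
  assumes "Partial_order r" "poset_hom r s f"
  shows "poset_map r f s \<Zsemi>\<^bsub>Poset\<^esub> poset_map s g t = poset_map r (\<lambda>x. g (f x)) t"
  using poset_hom_Field[OF assms(2,1)] by (auto simp: Poset_def poset_map_def restrict_def)

lemma poset_map_leq:
  assumes "Partial_order r"
  shows "poset_map r f s \<sqsubseteq>\<^bsub>Poset\<^esub> poset_map r g s \<longleftrightarrow> (\<forall>x\<in>Field r. (f x, g x) \<in> s)"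
  by (auto simp: Poset_def poset_map_def)

lemma prod_poset_iff:
  "(x, y) \<in> prod_poset r s \<longleftrightarrow>
     (\<exists>a b c d. x = Couple a b \<and> y = Couple c d \<and> (a, c) \<in> r \<and> (b, d) \<in> s)"
  by (auto simp: prod_poset_def)

lemma Field_prod_poset:
  assumes "Partial_order r" "Partial_order s"
  shows "Field (prod_poset r s) = {Couple a b | a b. a \<in> Field r \<and> b \<in> Field s}"
proof -
  have "Couple a b \<in> Field (prod_poset r s)" if "a \<in> Field r" "b \<in> Field s" for a b
    using that assms by (intro FieldI1[of _ "Couple a b"]) (simp add: Partial_order_refl prod_poset_iff)
  moreover have "\<exists>a b. x = Couple a b \<and> a \<in> Field r \<and> b \<in> Field s" if "x \<in> Field (prod_poset r s)" for x
    using that unfolding Field_def[of "prod_poset r s"] by (auto simp: prod_poset_iff) (blast intro: FieldI1 FieldI2)+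
  ultimately show ?thesis by blast
qed

lemma Field_unit_poset: "Field unit_poset = {Star}"
  by (auto simp: unit_poset_def)

lemma Partial_order_unit_poset: "Partial_order unit_poset"
  by (auto simp: unit_poset_def partial_order_on_def preorder_on_def refl_on_def trans_def antisym_def)

lemma Partial_order_prod_poset:
  assumes "Partial_order r" "Partial_order s"
  shows "Partial_order (prod_poset r s)"
proof -
  have "refl_on (Field (prod_poset r s)) (prod_poset r s)"
    using assms unfolding Field_prod_poset[OF assms]
    by (auto simp: refl_on_def prod_poset_iff Partial_order_refl)
  moreover have "trans (prod_poset r s)"
    using assms by (auto simp: trans_def prod_poset_iff intro: Partial_order_trans)
  moreover have "antisym (prod_poset r s)"
    using assms by (auto simp: antisym_def prod_poset_iff intro: Partial_order_antisym)
  moreover have "prod_poset r s \<subseteq> Field (prod_poset r s) \<times> Field (prod_poset r s)"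
    by (auto intro: FieldI1 FieldI2)
  ultimately show ?thesis by (simp add: partial_order_on_def preorder_on_def)
qed

lemma poset_map_ten:
  assumes "Partial_order r" "Partial_order r'"
  shows "poset_map r f s \<otimes>\<^bsub>Poset\<^esub> poset_map r' g s' =
    poset_map (prod_poset r r') (\<lambda>z. Couple (f (left z)) (g (right z))) (prod_poset s s')"
  using assms by (auto simp: Poset_def poset_map_def restrict_def Field_prod_poset fun_eq_iff)

lemma poset_hom_id: "poset_hom r r (\<lambda>x. x)"
  by (simp add: poset_hom_def)

lemma poset_hom_comp: "poset_hom r s f \<Longrightarrow> poset_hom s t g \<Longrightarrow> poset_hom r t (\<lambda>x. g (f x))"
  by (simp add: poset_hom_def)

lemma poset_hom_ten:
  "poset_hom r s f \<Longrightarrow> poset_hom r' s' g \<Longrightarrow>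
    poset_hom (prod_poset r r') (prod_poset s s') (\<lambda>z. Couple (f (left z)) (g (right z)))"
  by (auto simp: poset_hom_def prod_poset_iff)

text \<open>Besides the structure maps, the list contains the inverses of the associator and the two
  unitors, which serve as witnesses for \<open>poset_is_iso\<close>.\<close>

lemma poset_hom_structure:
  "poset_hom (prod_poset (prod_poset r s) t) (prod_poset r (prod_poset s t))
     (\<lambda>z. Couple (left (left z)) (Couple (right (left z)) (right z)))"
  "poset_hom (prod_poset r (prod_poset s t)) (prod_poset (prod_poset r s) t)
     (\<lambda>z. Couple (Couple (left z) (left (right z))) (right (right z)))"
  "poset_hom (prod_poset unit_poset r) r right"
  "poset_hom r (prod_poset unit_poset r) (Couple Star)"
  "poset_hom (prod_poset r unit_poset) r left"
  "poset_hom r (prod_poset r unit_poset) (\<lambda>x. Couple x Star)"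
  "poset_hom (prod_poset r s) (prod_poset s r) (\<lambda>z. Couple (right z) (left z))"
  by (auto simp: poset_hom_def prod_poset_iff unit_poset_def)

lemma mem_Field_prod_poset:
  assumes "Partial_order r" "Partial_order s"
  shows "x \<in> Field (prod_poset r s) \<longleftrightarrow> (\<exists>a b. x = Couple a b \<and> a \<in> Field r \<and> b \<in> Field s)"
  using Field_prod_poset[OF assms] by auto

lemma ball_Field_prod_poset:
  assumes "Partial_order r" "Partial_order s"
  shows "(\<forall>x\<in>Field (prod_poset r s). P x) \<longleftrightarrow> (\<forall>a\<in>Field r. \<forall>b\<in>Field s. P (Couple a b))"
  using Field_prod_poset[OF assms] by auto

lemma mem_Field_unit_poset: "x \<in> Field unit_poset \<longleftrightarrow> x = Star"
  by (simp add: Field_unit_poset)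

lemma ball_Field_unit_poset: "(\<forall>x\<in>Field unit_poset. P x) \<longleftrightarrow> P Star"
  by (simp add: Field_unit_poset)

lemma poset_hom_iff: "poset_hom r s f \<longleftrightarrow> (\<forall>p\<in>r. (f (fst p), f (snd p)) \<in> s)"
  by (auto simp: poset_hom_def)

lemma ball_prod_poset:
  "(\<forall>p\<in>prod_poset r s. P p) \<longleftrightarrow>
     (\<forall>p\<in>r. \<forall>q\<in>s. P (Couple (fst p) (fst q), Couple (snd p) (snd q)))"
  by (fastforce simp: prod_poset_def)

lemma ball_unit_poset: "(\<forall>p\<in>unit_poset. P p) \<longleftrightarrow> P (Star, Star)"
  by (simp add: unit_poset_def)

lemma Couple_prod_poset_iff:
  "(Couple a b, Couple c d) \<in> prod_poset r s \<longleftrightarrow> (a, c) \<in> r \<and> (b, d) \<in> s"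
  by (simp add: prod_poset_iff)

lemma Star_unit_poset: "(Star, Star) \<in> unit_poset"
  by (simp add: unit_poset_def)

lemmas Partial_orders = Partial_order_prod_poset Partial_order_unit_poset
text \<open>These rules turn an equation or inequality between \<open>poset_map\<close> arrows into
  a statement about elements, with quantifiers over products split into \<open>Couple\<close> terms
  on which the selectors compute.\<close>

lemmas poset_calc = poset_map_comp poset_map_ten poset_map_eq_iff poset_map_leq
  poset_hom_iff ball_prod_poset ball_unit_poset Couple_prod_poset_iff Star_unit_poset
  Partial_orders mem_Field_prod_poset ball_Field_prod_poset mem_Field_unit_poset ball_Field_unit_poset

lemma poset_is_iso:
  assumes "Partial_order r" "Partial_order s" "poset_hom r s f" "poset_hom s r g"
    and "\<And>x. x \<in> Field r \<Longrightarrow> g (f x) = x" "\<And>y. y \<in> Field s \<Longrightarrow> f (g y) = y"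
  shows "is_iso Poset (poset_map r f s)"
proof -
  have "poset_map r f s \<in> Arr Poset"
    using poset_map_hom[OF assms(1-3)] by (simp add: hom_def)
  then have "inverse_pair Poset (poset_map r f s) (poset_map s g r)"
    using assms poset_map_hom[OF assms(2,1,4)]
    by (simp add: inverse_pair_def poset_map_comp poset_map_eq_iff)
  then show ?thesis unfolding is_iso_def by blast
qed

section \<open>Posets form a symmetric monoidal po-category\<close>

lemma po_category_Poset: "po_category Poset"
proof
  fix f a b assume "f \<in> Arr Poset"
  then have "f \<in> hom Poset (Dom Poset f) (Cod Poset f)" by (simp add: hom_def)
  then show "Dom Poset f \<in> Ob Poset" "Cod Poset f \<in> Ob Poset"
    by (elim hom_PosetE, simp)+
next
  fix a assume "a \<in> Ob (Poset :: ('x poset, 'x poset_arr) smpocat)"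
  then show "Id Poset a \<in> hom Poset a a" by (auto intro!: poset_map_hom poset_hom_id)
next
  fix f g :: "'x poset_arr" and a b c
  assume "f \<in> hom Poset a b" "g \<in> hom Poset b c"
  then show "f \<Zsemi>\<^bsub>Poset\<^esub> g \<in> hom Poset a c"
    by (elim hom_PosetE) (simp add: poset_map_comp poset_map_hom poset_hom_comp[of a b])
next
  fix f :: "'x poset_arr" and a b
  assume "f \<in> hom Poset a b"
  then obtain u where f: "f = poset_map a u b" "poset_hom a b u" "Partial_order a" "Partial_order b"
    by (rule hom_PosetE)
  then show "Id Poset a \<Zsemi>\<^bsub>Poset\<^esub> f = f" "f \<Zsemi>\<^bsub>Poset\<^esub> Id Poset b = f"
    by (simp_all add: poset_map_comp poset_hom_id)
  have "(u x, u x) \<in> b" if "x \<in> Field a" for x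
    using poset_hom_Field[OF f(2,3) that] f(4) by (simp add: Partial_order_refl)
  then show "f \<sqsubseteq>\<^bsub>Poset\<^esub> f"
    using f by (simp add: poset_map_leq)
next
  fix f g h :: "'x poset_arr" and a b c d
  assume "f \<in> hom Poset a b" "g \<in> hom Poset b c" "h \<in> hom Poset c d"
  then show "f \<Zsemi>\<^bsub>Poset\<^esub> g \<Zsemi>\<^bsub>Poset\<^esub> h = f \<Zsemi>\<^bsub>Poset\<^esub> (g \<Zsemi>\<^bsub>Poset\<^esub> h)"
    by (elim hom_PosetE) (simp add: poset_map_comp poset_hom_comp[of a b])
next
  fix f g h :: "'x poset_arr" and a b
  assume "f \<in> hom Poset a b" "g \<in> hom Poset a b" "h \<in> hom Poset a b"
    "f \<sqsubseteq>\<^bsub>Poset\<^esub> g" "g \<sqsubseteq>\<^bsub>Poset\<^esub> h"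
  then show "f \<sqsubseteq>\<^bsub>Poset\<^esub> h"
    by (elim hom_PosetE) (simp add: poset_map_leq, meson Partial_order_trans)
next
  fix f g :: "'x poset_arr" and a b
  assume "f \<in> hom Poset a b" "g \<in> hom Poset a b" "f \<sqsubseteq>\<^bsub>Poset\<^esub> g" "g \<sqsubseteq>\<^bsub>Poset\<^esub> f"
  then show "f = g"
    by (elim hom_PosetE) (simp add: poset_map_leq poset_map_eq_iff, meson Partial_order_antisym)
next
  fix f f' g g' :: "'x poset_arr" and a b c
  assume "f \<in> hom Poset a b" "f' \<in> hom Poset a b" "g \<in> hom Poset b c" "g' \<in> hom Poset b c"
    and le: "f \<sqsubseteq>\<^bsub>Poset\<^esub> f'" "g \<sqsubseteq>\<^bsub>Poset\<^esub> g'"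
  then obtain u u' v v' where
    eqs: "f = poset_map a u b" "f' = poset_map a u' b" "g = poset_map b v c" "g' = poset_map b v' c"
    and homs: "poset_hom a b u" "poset_hom a b u'" "poset_hom b c v" "poset_hom b c v'"
    and po: "Partial_order a" "Partial_order b" "Partial_order c"
    by - (elim hom_PosetE, rule that)
  \<comment> \<open>The intermediate value is \<open>v (u' x)\<close>: monotonicity of
    \<open>v\<close> gives the first inequality, the pointwise order of \<open>v\<close> and
    \<open>v'\<close> the second.\<close>
  have "(v (u x), v' (u' x)) \<in> c" if x: "x \<in> Field a" for x
  proof -
    have "(v (u x), v (u' x)) \<in> c"
      using le(1) homs(3) x po by (simp add: eqs poset_map_leq poset_hom_def)
    moreover have "(v (u' x), v' (u' x)) \<in> c"
      using le(2) poset_hom_Field[OF homs(2) po(1) x] po by (simp add: eqs poset_map_leq)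
    ultimately show ?thesis
      using Partial_order_trans[OF po(3)] by blast
  qed
  then show "f \<Zsemi>\<^bsub>Poset\<^esub> g \<sqsubseteq>\<^bsub>Poset\<^esub> f' \<Zsemi>\<^bsub>Poset\<^esub> g'"
    using po homs by (simp add: eqs poset_map_comp poset_map_leq)
qed

lemma sym_mon_pocat_Poset: "sym_mon_pocat (Poset :: ('x poset, 'x poset_arr) smpocat)"
proof -
  interpret po_category "Poset :: ('x poset, 'x poset_arr) smpocat" by (rule po_category_Poset)
  show ?thesis
  proof
    show "Unit Poset \<in> Ob (Poset :: ('x poset, 'x poset_arr) smpocat)" by (simp add: Partial_orders)
  next
    fix a b c :: "'x poset"
    assume ob: "a \<in> Ob Poset" "b \<in> Ob Poset"
    then show "a \<odot>\<^bsub>Poset\<^esub> b \<in> Ob Poset" "Swap Poset a b \<in> hom Poset (a \<odot>\<^bsub>Poset\<^esub> b) (b \<odot>\<^bsub>Poset\<^esub> a)"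
      "Id Poset a \<otimes>\<^bsub>Poset\<^esub> Id Poset b = Id Poset (a \<odot>\<^bsub>Poset\<^esub> b)"
      "Swap Poset a b \<Zsemi>\<^bsub>Poset\<^esub> Swap Poset b a = Id Poset (a \<odot>\<^bsub>Poset\<^esub> b)"
      "Assoc Poset a (Unit Poset) b \<Zsemi>\<^bsub>Poset\<^esub> (Id Poset a \<otimes>\<^bsub>Poset\<^esub> LUnit Poset b)
         = RUnit Poset a \<otimes>\<^bsub>Poset\<^esub> Id Poset b"
      by (auto simp: poset_calc intro!: poset_map_hom)
    assume "c \<in> Ob Poset"
    with ob show "Assoc Poset a b c \<in> hom Poset (a \<odot>\<^bsub>Poset\<^esub> b \<odot>\<^bsub>Poset\<^esub> c) (a \<odot>\<^bsub>Poset\<^esub> (b \<odot>\<^bsub>Poset\<^esub> c))"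
      "is_iso Poset (Assoc Poset a b c)"
      "Assoc Poset a b c \<Zsemi>\<^bsub>Poset\<^esub> Swap Poset a (b \<odot>\<^bsub>Poset\<^esub> c) \<Zsemi>\<^bsub>Poset\<^esub> Assoc Poset b c a
         = (Swap Poset a b \<otimes>\<^bsub>Poset\<^esub> Id Poset c) \<Zsemi>\<^bsub>Poset\<^esub> Assoc Poset b a c
             \<Zsemi>\<^bsub>Poset\<^esub> (Id Poset b \<otimes>\<^bsub>Poset\<^esub> Swap Poset a c)"
      by (auto simp: poset_calc intro!: poset_map_hom poset_is_iso[OF _ _ _ poset_hom_structure(2)])
  next
    fix a :: "'x poset"
    assume "a \<in> Ob Poset"
    then show "LUnit Poset a \<in> hom Poset (Unit Poset \<odot>\<^bsub>Poset\<^esub> a) a" "is_iso Poset (LUnit Poset a)"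
      "RUnit Poset a \<in> hom Poset (a \<odot>\<^bsub>Poset\<^esub> Unit Poset) a" "is_iso Poset (RUnit Poset a)"
      by (auto simp: poset_calc intro!: poset_map_hom poset_is_iso[OF _ _ _ poset_hom_structure(4)]
            poset_is_iso[OF _ _ _ poset_hom_structure(6)])
  next
    fix a b c d :: "'x poset"
    assume "a \<in> Ob Poset" "b \<in> Ob Poset" "c \<in> Ob Poset" "d \<in> Ob Poset"
    then show "(Assoc Poset a b c \<otimes>\<^bsub>Poset\<^esub> Id Poset d) \<Zsemi>\<^bsub>Poset\<^esub> Assoc Poset a (b \<odot>\<^bsub>Poset\<^esub> c) d
        \<Zsemi>\<^bsub>Poset\<^esub> (Id Poset a \<otimes>\<^bsub>Poset\<^esub> Assoc Poset b c d)
      = Assoc Poset (a \<odot>\<^bsub>Poset\<^esub> b) c d \<Zsemi>\<^bsub>Poset\<^esub> Assoc Poset a b (c \<odot>\<^bsub>Poset\<^esub> d)"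
      by (auto simp: poset_calc)
  next
    fix f g h :: "'x poset_arr" and a b c d k l
    assume "f \<in> hom Poset a b" "g \<in> hom Poset c d"
    then obtain u v where eqs: "f = poset_map a u b" "g = poset_map c v d"
      and homs: "poset_hom a b u" "poset_hom c d v"
      and po: "Partial_order a" "Partial_order b" "Partial_order c" "Partial_order d"
      by - (elim hom_PosetE, rule that)
    from homs po show
      "f \<otimes>\<^bsub>Poset\<^esub> g \<in> hom Poset (a \<odot>\<^bsub>Poset\<^esub> c) (b \<odot>\<^bsub>Poset\<^esub> d)"
      "(f \<otimes>\<^bsub>Poset\<^esub> g) \<Zsemi>\<^bsub>Poset\<^esub> Swap Poset b d = Swap Poset a c \<Zsemi>\<^bsub>Poset\<^esub> (g \<otimes>\<^bsub>Poset\<^esub> f)"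
      by (auto simp: eqs poset_calc intro!: poset_map_hom)
    from homs po show
      "(Id Poset (Unit Poset) \<otimes>\<^bsub>Poset\<^esub> f) \<Zsemi>\<^bsub>Poset\<^esub> LUnit Poset b = LUnit Poset a \<Zsemi>\<^bsub>Poset\<^esub> f"
      "(f \<otimes>\<^bsub>Poset\<^esub> Id Poset (Unit Poset)) \<Zsemi>\<^bsub>Poset\<^esub> RUnit Poset b = RUnit Poset a \<Zsemi>\<^bsub>Poset\<^esub> f"
      by (auto simp: eqs poset_calc intro!: poset_map_hom)
    assume "h \<in> hom Poset k l"
    then obtain w where h: "h = poset_map k w l" "poset_hom k l w" "Partial_order k" "Partial_order l"
      by - (elim hom_PosetE, rule that)
    with homs po show "(f \<otimes>\<^bsub>Poset\<^esub> g \<otimes>\<^bsub>Poset\<^esub> h) \<Zsemi>\<^bsub>Poset\<^esub> Assoc Poset b d l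
        = Assoc Poset a c k \<Zsemi>\<^bsub>Poset\<^esub> (f \<otimes>\<^bsub>Poset\<^esub> (g \<otimes>\<^bsub>Poset\<^esub> h))"
      by (auto simp: eqs poset_calc)
  next
    fix f f' g g' :: "'x poset_arr" and a b c d e k
    assume "f \<in> hom Poset a b" "f' \<in> hom Poset b c" "g \<in> hom Poset d e" "g' \<in> hom Poset e k"
    then show "(f \<Zsemi>\<^bsub>Poset\<^esub> f') \<otimes>\<^bsub>Poset\<^esub> (g \<Zsemi>\<^bsub>Poset\<^esub> g') = (f \<otimes>\<^bsub>Poset\<^esub> g) \<Zsemi>\<^bsub>Poset\<^esub> (f' \<otimes>\<^bsub>Poset\<^esub> g')"
      by (elim hom_PosetE) (auto simp: poset_calc)
  next
    fix f f' g g' :: "'x poset_arr" and a b c d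
    assume "f \<in> hom Poset a b" "f' \<in> hom Poset a b" "g \<in> hom Poset c d" "g' \<in> hom Poset c d"
      "f \<sqsubseteq>\<^bsub>Poset\<^esub> f'" "g \<sqsubseteq>\<^bsub>Poset\<^esub> g'"
    then show "f \<otimes>\<^bsub>Poset\<^esub> g \<sqsubseteq>\<^bsub>Poset\<^esub> f' \<otimes>\<^bsub>Poset\<^esub> g'"
      by (elim hom_PosetE) (auto simp: poset_calc prod_poset_iff)
  qed
qed

text \<open>Unit and counit of an adjunction in \<open>Poset\<close> are pointwise inequalities, so
  the unit-counit form of a Galois connection is enough.\<close>

lemma poset_left_adjoint:
  assumes "Partial_order r" "Partial_order s" "poset_hom r s f" "poset_hom s r g"
    and "\<And>x. x \<in> Field r \<Longrightarrow> (x, g (f x)) \<in> r" "\<And>y. y \<in> Field s \<Longrightarrow> (f (g y), y) \<in> s"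
  shows "left_adjoint Poset (poset_map r f s) (poset_map s g r)"
proof -
  have "poset_map r f s \<in> Arr Poset"
    using poset_map_hom[OF assms(1-3)] by (simp add: hom_def)
  then show ?thesis
    using assms poset_map_hom[OF assms(2,1,4)]
    by (simp add: left_adjoint_def poset_map_comp poset_map_leq)
qed

section \<open>Subobjects and isomorphisms\<close>

context category
begin

lemma hom_ob: "f \<in> hom C a b \<Longrightarrow> a \<in> Ob C \<and> b \<in> Ob C"
  using dom_ob cod_ob by (auto simp: hom_def)

lemma is_mono_hom: "is_mono C m \<Longrightarrow> m \<in> hom C (Dom C m) (Cod C m)"
  by (simp add: is_mono_def hom_def)

lemma is_monoD:
  "is_mono C m \<Longrightarrow> f \<in> hom C x (Dom C m) \<Longrightarrow> g \<in> hom C x (Dom C m) \<Longrightarrow> f \<Zsemi> m = g \<Zsemi> m \<Longrightarrow> f = g"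
  unfolding is_mono_def by blast

lemma is_monoI:
  assumes "m \<in> hom C a b"
    and "\<And>x f g. f \<in> hom C x a \<Longrightarrow> g \<in> hom C x a \<Longrightarrow> f \<Zsemi> m = g \<Zsemi> m \<Longrightarrow> f = g"
  shows "is_mono C m"
  using assms unfolding is_mono_def hom_def by blast

text \<open>Arrows identified by \<open>f\<close> are also identified by
  \<open>f \<Zsemi> g\<close>.\<close>

lemma is_mono_comp_cancel:
  assumes "f \<in> hom C a b" "g \<in> hom C b c" "is_mono C (f \<Zsemi> g)"
  shows "is_mono C f"
proof (rule is_monoI[OF assms(1)])
  fix x h k assume hk: "h \<in> hom C x a" "k \<in> hom C x a" "h \<Zsemi> f = k \<Zsemi> f"
  have "Dom C (f \<Zsemi> g) = a" using comp_hom[OF assms(1,2)] by (simp add: hom_def)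
  then show "h = k"
    using is_monoD[OF assms(3), of h x k] hk
      comp_assoc[OF hk(1) assms(1,2)] comp_assoc[OF hk(2) assms(1,2)] by simp
qed

text \<open>Following \<open>m \<Zsemi> p\<close> by the retraction \<open>j\<close> gives the mono
  \<open>m\<close> back, so cancellation applies.\<close>

lemma is_mono_comp_iso:
  assumes "is_mono C m" "m \<in> hom C d a" "p \<in> hom C a b" "j \<in> hom C b a" "p \<Zsemi> j = Id C a"
  shows "is_mono C (m \<Zsemi> p)"
proof (rule is_mono_comp_cancel[OF comp_hom[OF assms(2,3)] assms(4)])
  show "is_mono C (m \<Zsemi> p \<Zsemi> j)"
    using assms comp_assoc[OF assms(2-4)] id_right[OF assms(2)] by simp
qed

lemma is_iso_Id:
  assumes "a \<in> Ob C"
  shows "is_iso C (Id C a)"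
proof -
  have "inverse_pair C (Id C a) (Id C a)"
    using id_hom[OF assms] id_left[OF id_hom[OF assms]] by (simp add: inverse_pair_def hom_def)
  then show ?thesis unfolding is_iso_def by blast
qed

lemma is_isoE:
  assumes "is_iso C f" "f \<in> hom C a b"
  obtains g where "g \<in> hom C b a" "f \<Zsemi> g = Id C a" "g \<Zsemi> f = Id C b"
  using assms by (auto simp: is_iso_def inverse_pair_def hom_def)

section \<open>Representatives of a subobject\<close>

lemma sub_classD:
  assumes "m' \<in> sub_class C m"
  shows "is_mono C m'" "Cod C m' = Cod C m"
  using assms by (auto simp: sub_class_def)

lemma mem_sub_class_self:
  assumes "is_mono C m"
  shows "m \<in> sub_class C m"
proof -
  note m = is_mono_hom[OF assms]
  have ob: "Dom C m \<in> Ob C" using hom_ob[OF m] by simp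
  show ?thesis
    unfolding sub_class_def using assms id_left[OF m] is_iso_Id[OF ob] id_hom[OF ob] by blast
qed

lemma Sub_memD:
  assumes "S \<in> Sub C a" "m \<in> S"
  shows "is_mono C m" "m \<in> hom C (Dom C m) a"
proof -
  show "is_mono C m" using assms sub_classD unfolding Sub_def by blast
  moreover have "Cod C m = a" using assms sub_classD unfolding Sub_def by blast
  ultimately show "m \<in> hom C (Dom C m) a" using is_mono_hom by blast
qed

lemma Sub_nonempty: "S \<in> Sub C a \<Longrightarrow> \<exists>m. m \<in> S"
  using mem_sub_class_self unfolding Sub_def by blast

text \<open>Both members are isomorphic to the representative \<open>k\<close> of the class; the
  factorization runs through \<open>k\<close> and back along the inverse \<open>j\<close>. It makes
  tests on generalized elements independent of the representative.\<close>

lemma Sub_factor: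
  assumes S: "S \<in> Sub C a" and mn: "m \<in> S" "n \<in> S"
  shows "\<exists>i\<in>hom C (Dom C m) (Dom C n). i \<Zsemi> n = m"
proof -
  obtain k where k: "is_mono C k" "Cod C k = a" and Sk: "S = sub_class C k"
    using S by (auto simp: Sub_def)
  have k_hom: "k \<in> hom C (Dom C k) a" using is_mono_hom[OF k(1)] k(2) by simp
  obtain i where i: "i \<in> hom C (Dom C m) (Dom C k)" "i \<Zsemi> k = m"
    using mn(1) by (auto simp: Sk sub_class_def)
  obtain i' where i': "i' \<in> hom C (Dom C n) (Dom C k)" "i' \<Zsemi> k = n" "is_iso C i'"
    using mn(2) by (auto simp: Sk sub_class_def)
  obtain j where j: "j \<in> hom C (Dom C k) (Dom C n)" "j \<Zsemi> i' = Id C (Dom C k)"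
    using i'(3,1) by (rule is_isoE)
  have "j \<Zsemi> n = k"
    using comp_assoc[OF j(1) i'(1) k_hom] j(2) i'(2) id_left[OF k_hom] by simp
  then have "(i \<Zsemi> j) \<Zsemi> n = m"
    using comp_assoc[OF i(1) j(1) Sub_memD(2)[OF S mn(2)]] i(2) by simp
  then show ?thesis using comp_hom[OF i(1) j(1)] by blast
qed

section \<open>Transport of subobjects and images along an isomorphism\<close>

lemma post_comp_iso_sub_class:
  assumes m: "is_mono C m" "Cod C m = a"
    and p: "p \<in> hom C a b" "j \<in> hom C b a" "p \<Zsemi> j = Id C a"
  shows "(\<lambda>k. k \<Zsemi> p) ` sub_class C m = sub_class C (m \<Zsemi> p)"
proof -
  have m_hom: "m \<in> hom C (Dom C m) a" using is_mono_hom[OF m(1)] m(2) by simp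
  have mp: "m \<Zsemi> p \<in> hom C (Dom C m) b" by (rule comp_hom[OF m_hom p(1)])
  have *: "Dom C (m \<Zsemi> p) = Dom C m" "Cod C (m \<Zsemi> p) = b" using mp by (simp_all add: hom_def)
  show ?thesis
  proof (intro equalityI subsetI)
    fix k' assume "k' \<in> (\<lambda>k. k \<Zsemi> p) ` sub_class C m"
    then obtain k i where k: "k' = k \<Zsemi> p" "is_mono C k" "Cod C k = a"
      and i: "i \<in> hom C (Dom C k) (Dom C m)" "is_iso C i" "i \<Zsemi> m = k"
      using m(2) by (auto simp: sub_class_def)
    have k_hom: "k \<in> hom C (Dom C k) a" using is_mono_hom[OF k(2)] k(3) by simp
    have kp: "k \<Zsemi> p \<in> hom C (Dom C k) b" by (rule comp_hom[OF k_hom p(1)])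
    have "is_mono C (k \<Zsemi> p)" by (rule is_mono_comp_iso[OF k(2) k_hom p])
    moreover have "i \<Zsemi> (m \<Zsemi> p) = k \<Zsemi> p" using comp_assoc[OF i(1) m_hom p(1)] i(3) by simp
    moreover have "Dom C (k \<Zsemi> p) = Dom C k" "Cod C (k \<Zsemi> p) = b" using kp by (simp_all add: hom_def)
    ultimately show "k' \<in> sub_class C (m \<Zsemi> p)"
      using i(1,2) * by (auto simp: sub_class_def k(1))
  next
    fix k' assume k': "k' \<in> sub_class C (m \<Zsemi> p)"
    then obtain i where i: "i \<in> hom C (Dom C k') (Dom C m)" "is_iso C i" "i \<Zsemi> (m \<Zsemi> p) = k'"
      using * by (auto simp: sub_class_def)
    \<comment> \<open>The preimage of \<open>k'\<close> is \<open>i \<Zsemi> m\<close>; it is a mono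
      because its composite with \<open>p\<close> is the mono \<open>k'\<close>.\<close>
    have im: "i \<Zsemi> m \<in> hom C (Dom C k') a" by (rule comp_hom[OF i(1) m_hom])
    have k'_eq: "k' = i \<Zsemi> m \<Zsemi> p" using comp_assoc[OF i(1) m_hom p(1)] i(3) by simp
    have "is_mono C (i \<Zsemi> m)"
      using is_mono_comp_cancel[OF im p(1)] sub_classD(1)[OF k'] k'_eq by simp
    moreover have "Dom C (i \<Zsemi> m) = Dom C k'" "Cod C (i \<Zsemi> m) = a" using im by (simp_all add: hom_def)
    ultimately have "i \<Zsemi> m \<in> sub_class C m"
      using i(1,2) m(2) by (auto simp: sub_class_def)
    then show "k' \<in> (\<lambda>k. k \<Zsemi> p) ` sub_class C m" using k'_eq by blast
  qed
qed

lemma post_comp_iso_Sub: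
  assumes p: "p \<in> hom C a b" "j \<in> hom C b a" "p \<Zsemi> j = Id C a" and S: "S \<in> Sub C a"
  shows "(\<lambda>k. k \<Zsemi> p) ` S \<in> Sub C b" "(\<lambda>k. k \<Zsemi> j) ` (\<lambda>k. k \<Zsemi> p) ` S = S"
proof -
  obtain m where m: "is_mono C m" "Cod C m = a" and Sm: "S = sub_class C m"
    using S by (auto simp: Sub_def)
  have m_hom: "m \<in> hom C (Dom C m) a" using is_mono_hom[OF m(1)] m(2) by simp
  have "is_mono C (m \<Zsemi> p)" "Cod C (m \<Zsemi> p) = b"
    using is_mono_comp_iso[OF m(1) m_hom p] comp_hom[OF m_hom p(1)] by (simp_all add: hom_def)
  then show "(\<lambda>k. k \<Zsemi> p) ` S \<in> Sub C b"
    unfolding Sm post_comp_iso_sub_class[OF m p] Sub_def by blast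
  have "k \<Zsemi> p \<Zsemi> j = k" if "k \<in> S" for k
    using comp_assoc[OF Sub_memD(2)[OF S that] p(1,2)] p(3) id_right[OF Sub_memD(2)[OF S that]] by simp
  then show "(\<lambda>k. k \<Zsemi> j) ` (\<lambda>k. k \<Zsemi> p) ` S = S" by (simp add: image_image)
qed

lemma post_comp_iso_bij_Sub:
  assumes p: "p \<in> hom C a b" "j \<in> hom C b a" "p \<Zsemi> j = Id C a" "j \<Zsemi> p = Id C b"
  shows "bij_betw (image (\<lambda>k. k \<Zsemi> p)) (Sub C a) (Sub C b)"
  by (rule bij_betw_byWitness[where f' = "image (\<lambda>k. k \<Zsemi> j)"])
    (simp_all add: image_subset_iff post_comp_iso_Sub[OF p(1-3)] post_comp_iso_Sub[OF p(2,1,4)] del: image_image)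

lemma post_comp_iso_sub_le:
  assumes p: "p \<in> hom C a b" "j \<in> hom C b a" "p \<Zsemi> j = Id C a"
    and S: "S \<in> Sub C a" and T: "T \<in> Sub C a"
  shows "sub_le C ((\<lambda>k. k \<Zsemi> p) ` S) ((\<lambda>k. k \<Zsemi> p) ` T) \<longleftrightarrow> sub_le C S T"
proof -
  have *: "(\<exists>h\<in>hom C (Dom C (m \<Zsemi> p)) (Dom C (n \<Zsemi> p)). h \<Zsemi> (n \<Zsemi> p) = m \<Zsemi> p) \<longleftrightarrow>
      (\<exists>h\<in>hom C (Dom C m) (Dom C n). h \<Zsemi> n = m)" if "m \<in> S" "n \<in> T" for m n
  proof -
    note m = Sub_memD(2)[OF S that(1)] and n = Sub_memD(2)[OF T that(2)]
    have "Dom C (m \<Zsemi> p) = Dom C m" "Dom C (n \<Zsemi> p) = Dom C n"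
      using comp_hom[OF m p(1)] comp_hom[OF n p(1)] by (simp_all add: hom_def)
    moreover have "h \<Zsemi> (n \<Zsemi> p) = m \<Zsemi> p \<longleftrightarrow> h \<Zsemi> n = m" if h: "h \<in> hom C (Dom C m) (Dom C n)" for h
    proof
      assume "h \<Zsemi> (n \<Zsemi> p) = m \<Zsemi> p"
      \<comment> \<open>The retraction \<open>j\<close> cancels \<open>p\<close> on the
        right.\<close>
      then have "h \<Zsemi> n \<Zsemi> p \<Zsemi> j = m \<Zsemi> p \<Zsemi> j" using comp_assoc[OF h n p(1)] by simp
      then show "h \<Zsemi> n = m"
        using comp_assoc[OF comp_hom[OF h n] p(1,2)] comp_assoc[OF m p(1,2)] p(3)
          id_right[OF comp_hom[OF h n]] id_right[OF m] by simp
    next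
      assume "h \<Zsemi> n = m"
      then show "h \<Zsemi> (n \<Zsemi> p) = m \<Zsemi> p" using comp_assoc[OF h n p(1)] by simp
    qed
    ultimately show ?thesis by auto
  qed
  have "sub_le C ((\<lambda>k. k \<Zsemi> p) ` S) ((\<lambda>k. k \<Zsemi> p) ` T) \<longleftrightarrow>
      (\<exists>m\<in>S. \<exists>n\<in>T. \<exists>h\<in>hom C (Dom C (m \<Zsemi> p)) (Dom C (n \<Zsemi> p)). h \<Zsemi> (n \<Zsemi> p) = m \<Zsemi> p)"
    by (simp add: sub_le_def)
  also have "\<dots> \<longleftrightarrow> sub_le C S T"
    unfolding sub_le_def by (intro bex_cong refl *)
  finally show ?thesis .
qed

lemma image_subD:
  assumes "m \<in> image_sub C f" "f \<in> hom C d a"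
  obtains e where "is_mono C m" "m \<in> hom C (Dom C m) a" "is_regular_epi C e" "e \<in> hom C d (Dom C m)"
    "e \<Zsemi> m = f"
proof -
  obtain e where e: "is_mono C m" "is_regular_epi C e" "e \<in> hom C (Dom C f) (Dom C m)" "e \<Zsemi> m = f"
    using assms(1) by (auto simp: image_sub_def)
  have "f \<in> hom C d (Cod C m)"
    using comp_hom[OF e(3) is_mono_hom[OF e(1)]] e(4) assms(2) by (simp add: hom_def)
  then have "Cod C m = a" "Dom C f = d" using assms(2) by (simp_all add: hom_def)
  then show thesis using that e is_mono_hom[OF e(1)] by simp
qed

text \<open>A factorization of \<open>f\<close> yields one of \<open>f \<Zsemi> p\<close> with the
  same regular epimorphism: only the mono part is composed with the isomorphism.\<close>

lemma post_comp_iso_image_sub: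
  assumes f: "f \<in> hom C d a"
    and p: "p \<in> hom C a b" "j \<in> hom C b a" "p \<Zsemi> j = Id C a" "j \<Zsemi> p = Id C b"
  shows "(\<lambda>k. k \<Zsemi> p) ` image_sub C f = image_sub C (f \<Zsemi> p)"
proof -
  \<comment> \<open>Stated for arbitrary \<open>g\<close> and \<open>q\<close>, since one inclusion
    uses it for \<open>p\<close> and the other for \<open>j\<close>.\<close>
  have *: "k \<Zsemi> q \<in> image_sub C (g \<Zsemi> q)"
    if k: "k \<in> image_sub C g" and g: "g \<in> hom C d a'" and q: "q \<in> hom C a' b'" "i \<in> hom C b' a'"
      "q \<Zsemi> i = Id C a'" for k g q i a' b'
  proof -
    obtain e where m: "is_mono C k" "k \<in> hom C (Dom C k) a'"
      and e: "is_regular_epi C e" "e \<in> hom C d (Dom C k)" "e \<Zsemi> k = g"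
      using k g by (rule image_subD)
    have "Dom C (k \<Zsemi> q) = Dom C k" "Dom C (g \<Zsemi> q) = d"
      using comp_hom[OF m(2) q(1)] comp_hom[OF g q(1)] by (simp_all add: hom_def)
    moreover have "e \<Zsemi> (k \<Zsemi> q) = g \<Zsemi> q" using comp_assoc[OF e(2) m(2) q(1)] e(3) by simp
    ultimately show ?thesis
      using is_mono_comp_iso[OF m q] e unfolding image_sub_def by auto
  qed
  have fp: "f \<Zsemi> p \<in> hom C d b" by (rule comp_hom[OF f p(1)])
  have fpj: "f \<Zsemi> p \<Zsemi> j = f" using comp_assoc[OF f p(1,2)] p(3) id_right[OF f] by simp
  show ?thesis
  proof (intro equalityI subsetI)
    fix k assume "k \<in> (\<lambda>k. k \<Zsemi> p) ` image_sub C f"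
    then show "k \<in> image_sub C (f \<Zsemi> p)" using *[OF _ f p(1-3)] by blast
  next
    fix k assume k: "k \<in> image_sub C (f \<Zsemi> p)"
    then have k_hom: "k \<in> hom C (Dom C k) b" using fp by (rule image_subD)
    have "k \<Zsemi> j \<Zsemi> p = k" using comp_assoc[OF k_hom p(2,1)] p(4) id_right[OF k_hom] by simp
    moreover have "k \<Zsemi> j \<in> image_sub C f" using *[OF k fp p(2,1,4)] fpj by simp
    ultimately show "k \<in> (\<lambda>k. k \<Zsemi> p) ` image_sub C f" by (metis imageI)
  qed
qed

text \<open>As \<open>inverse_arr\<close> is a definite description, uniqueness of inverses is what
  gives access to its value.\<close>

lemma inverse_arr_pair:
  assumes "is_iso C f"
  shows "inverse_pair C f (inverse_arr C f)"
proof -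
  obtain g where g: "inverse_pair C f g" using assms by (auto simp: is_iso_def)
  have "h = g" if h: "inverse_pair C f h" for h
  proof -
    have f: "f \<in> hom C (Dom C f) (Cod C f)" using g by (simp add: inverse_pair_def hom_def)
    have gh: "g \<in> hom C (Cod C f) (Dom C f)" "h \<in> hom C (Cod C f) (Dom C f)"
      using g h by (simp_all add: inverse_pair_def)
    have "h = (g \<Zsemi> f) \<Zsemi> h" using g gh by (simp add: inverse_pair_def id_left)
    also have "\<dots> = g" using h comp_assoc[OF gh(1) f gh(2)] gh by (simp add: inverse_pair_def id_right)
    finally show ?thesis .
  qed
  with g show ?thesis unfolding inverse_arr_def by (rule theI)
qed

lemma inverse_arr:
  assumes "is_iso C f" "f \<in> hom C a b"
  shows "inverse_arr C f \<in> hom C b a" "f \<Zsemi> inverse_arr C f = Id C a" "inverse_arr C f \<Zsemi> f = Id C b"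
  using inverse_arr_pair[OF assms(1)] assms(2) by (auto simp: inverse_pair_def hom_def)

end

section \<open>Generalized elements of relations\<close>

text \<open>Generalized elements: \<open>(f, g) : x \<rightarrow> r \<times> s\<close> factors through the relation.\<close>

definition rel_holds :: "('o, 'a, 'z) fpcat_scheme \<Rightarrow> ('o, 'a) rel_arr \<Rightarrow> 'a \<Rightarrow> 'a \<Rightarrow> bool" where
  "rel_holds C = (\<lambda>(r, S, s) f g. \<exists>m\<in>S. \<exists>h\<in>hom C (Dom C f) (Dom C m).
     h \<Zsemi>\<^bsub>C\<^esub> (m \<Zsemi>\<^bsub>C\<^esub> Pr1 C r s) = f \<and> h \<Zsemi>\<^bsub>C\<^esub> (m \<Zsemi>\<^bsub>C\<^esub> Pr2 C r s) = g)"

lemma Rel_simps [simp]: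
  "Ob (Rel C) = Ob C" "Comp (Rel C) = rel_comp C" "TenO (Rel C) = Prod C" "TenA (Rel C) = rel_ten C"
  "Unit (Rel C) = One C" "Id (Rel C) r = graph C (Id C r)"
  "LUnit (Rel C) r = graph C (Pr2 C (One C) r)" "RUnit (Rel C) r = graph C (Pr1 C r (One C))"
  "Swap (Rel C) r s = graph C (tuple C (Pr2 C r s) (Pr1 C r s))"
  "Leq (Rel C) (r, S, s) (r', T, s') = sub_le C S T"
  by (simp_all add: Rel_def)

lemma hom_Rel:
  "X \<in> hom (Rel C) r s \<longleftrightarrow> (\<exists>S. X = (r, S, s) \<and> r \<in> Ob C \<and> s \<in> Ob C \<and> S \<in> Sub C (Prod C r s))"
  by (auto simp: Rel_def hom_def)

context regular_category_chosen_products
begin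

section \<open>Chosen products and the terminal object\<close>

lemma Pr_hom:
  assumes "a \<in> Ob C" "b \<in> Ob C"
  shows "Pr1 C a b \<in> hom C (a \<boxtimes> b) a" "Pr2 C a b \<in> hom C (a \<boxtimes> b) b"
  using prod_product[OF assms] by (simp_all add: is_product_def)

lemma product_ext:
  assumes "a \<in> Ob C" "b \<in> Ob C" "h \<in> hom C x (a \<boxtimes> b)" "k \<in> hom C x (a \<boxtimes> b)"
    "h \<Zsemi> Pr1 C a b = k \<Zsemi> Pr1 C a b" "h \<Zsemi> Pr2 C a b = k \<Zsemi> Pr2 C a b"
  shows "h = k"
proof -
  note pr = Pr_hom[OF assms(1,2)]
  have "\<exists>!l. l \<in> hom C x (a \<boxtimes> b) \<and> l \<Zsemi> Pr1 C a b = h \<Zsemi> Pr1 C a b \<and> l \<Zsemi> Pr2 C a b = h \<Zsemi> Pr2 C a b"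
    using prod_product[OF assms(1,2)] comp_hom[OF assms(3) pr(1)] comp_hom[OF assms(3) pr(2)]
    unfolding is_product_def by blast
  then show ?thesis using assms(3-6) by metis
qed

lemma tuple:
  assumes "f \<in> hom C x a" "g \<in> hom C x b"
  shows "tuple C f g \<in> hom C x (a \<boxtimes> b)" "tuple C f g \<Zsemi> Pr1 C a b = f" "tuple C f g \<Zsemi> Pr2 C a b = g"
proof -
  have ob: "a \<in> Ob C" "b \<in> Ob C" using hom_ob assms by auto
  have *: "Dom C f = x" "Cod C f = a" "Cod C g = b" using assms by (simp_all add: hom_def)
  have "\<exists>!h. h \<in> hom C x (a \<boxtimes> b) \<and> h \<Zsemi> Pr1 C a b = f \<and> h \<Zsemi> Pr2 C a b = g"
    using prod_product[OF ob] assms unfolding is_product_def by blast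
  from theI'[OF this] show "tuple C f g \<in> hom C x (a \<boxtimes> b)"
    "tuple C f g \<Zsemi> Pr1 C a b = f" "tuple C f g \<Zsemi> Pr2 C a b = g"
    unfolding tuple_def * by blast+
qed

lemma tuple_eqI:
  assumes "h \<in> hom C x (a \<boxtimes> b)" "a \<in> Ob C" "b \<in> Ob C" "h \<Zsemi> Pr1 C a b = f" "h \<Zsemi> Pr2 C a b = g"
  shows "h = tuple C f g"
proof -
  note pr = Pr_hom[OF assms(2,3)]
  have "f \<in> hom C x a" "g \<in> hom C x b"
    using comp_hom[OF assms(1) pr(1)] comp_hom[OF assms(1) pr(2)] assms(4,5) by simp_all
  from tuple[OF this] show ?thesis using product_ext[OF assms(2,3,1)] assms(4,5) by simp
qed

lemma comp_tuple:
  assumes "w \<in> hom C y x" "f \<in> hom C x a" "g \<in> hom C x b"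
  shows "w \<Zsemi> tuple C f g = tuple C (w \<Zsemi> f) (w \<Zsemi> g)"
proof -
  have ob: "a \<in> Ob C" "b \<in> Ob C" using hom_ob assms by auto
  note t = tuple[OF assms(2,3)] and pr = Pr_hom[OF ob]
  show ?thesis
    using comp_assoc[OF assms(1) t(1) pr(1)] comp_assoc[OF assms(1) t(1) pr(2)] t(2,3)
    by (intro tuple_eqI[OF comp_hom[OF assms(1) t(1)] ob]) simp_all
qed

lemma One_ob: "One C \<in> Ob C"
  using one_terminal by (simp add: is_terminal_def)

lemma One_unique: "f \<in> hom C a (One C) \<Longrightarrow> g \<in> hom C a (One C) \<Longrightarrow> f = g"
  using one_terminal hom_ob[of f] unfolding is_terminal_def by blast

lemma One_arrow: "a \<in> Ob C \<Longrightarrow> \<exists>f. f \<in> hom C a (One C)"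
  using one_terminal unfolding is_terminal_def by blast

text \<open>The inverse pairs the map to the terminal object with the identity. On
  \<open>One C \<boxtimes> a\<close> the first components agree by terminality, the second by
  computation.\<close>

lemma Pr2_One_iso:
  assumes "a \<in> Ob C"
  obtains j where "j \<in> hom C a (One C \<boxtimes> a)" "Pr2 C (One C) a \<Zsemi> j = Id C (One C \<boxtimes> a)"
    "j \<Zsemi> Pr2 C (One C) a = Id C a"
proof -
  obtain t where t: "t \<in> hom C a (One C)" using One_arrow[OF assms] by blast
  define j where "j = tuple C t (Id C a)"
  note j = tuple[OF t id_hom[OF assms], folded j_def] and pr = Pr_hom[OF One_ob assms]
  note pj = comp_hom[OF pr(2) j(1)]
  have ob: "One C \<boxtimes> a \<in> Ob C" using hom_ob[OF pr(1)] by simp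
  have "Pr2 C (One C) a \<Zsemi> j = Id C (One C \<boxtimes> a)"
    by (rule product_ext[OF One_ob assms pj id_hom[OF ob]])
      (use One_unique[OF comp_hom[OF pj pr(1)] pr(1)] comp_assoc[OF pr(2) j(1) pr(2)] j(3)
        id_right[OF pr(2)] id_left[OF pr(1)] id_left[OF pr(2)] in simp_all)
  then show thesis using that j by blast
qed

section \<open>The order of relations in terms of generalized elements\<close>

lemma mem_hom_Rel:
  assumes "(r, S, s) \<in> hom (Rel C) r' s'" "m \<in> S"
  shows "is_mono C m" "m \<in> hom C (Dom C m) (r \<boxtimes> s)"
    "m \<Zsemi> Pr1 C r s \<in> hom C (Dom C m) r" "m \<Zsemi> Pr2 C r s \<in> hom C (Dom C m) s"
proof -
  have S: "S \<in> Sub C (r \<boxtimes> s)" and ob: "r \<in> Ob C" "s \<in> Ob C" using assms(1) by (auto simp: hom_Rel)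
  show m: "is_mono C m" "m \<in> hom C (Dom C m) (r \<boxtimes> s)" using Sub_memD[OF S assms(2)] by auto
  show "m \<Zsemi> Pr1 C r s \<in> hom C (Dom C m) r" "m \<Zsemi> Pr2 C r s \<in> hom C (Dom C m) s"
    using comp_hom[OF m(2)] Pr_hom[OF ob] by auto
qed

lemma rel_holds_hom:
  assumes "X \<in> hom (Rel C) r s" "rel_holds C X f g"
  shows "f \<in> hom C (Dom C f) r" "g \<in> hom C (Dom C f) s"
proof -
  obtain S where X: "X = (r, S, s)" using assms(1) by (auto simp: hom_Rel)
  obtain m h where m: "m \<in> S" and h: "h \<in> hom C (Dom C f) (Dom C m)"
    and eq: "h \<Zsemi> (m \<Zsemi> Pr1 C r s) = f" "h \<Zsemi> (m \<Zsemi> Pr2 C r s) = g"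
    using assms(2) by (auto simp: X rel_holds_def)
  note mm = mem_hom_Rel[OF assms(1)[unfolded X] m]
  show "f \<in> hom C (Dom C f) r" "g \<in> hom C (Dom C f) s"
    using comp_hom[OF h mm(3)] comp_hom[OF h mm(4)] eq by simp_all
qed

text \<open>The definition of \<open>rel_holds\<close> asks for some representative. By
  \<open>Sub_factor\<close> every representative will do, so several elements can be factored
  through one fixed mono.\<close>

lemma rel_holdsE:
  assumes X: "(r, S, s) \<in> hom (Rel C) r s" and "rel_holds C (r, S, s) f g" and m: "m \<in> S"
  obtains h where "h \<in> hom C (Dom C f) (Dom C m)"
    "h \<Zsemi> (m \<Zsemi> Pr1 C r s) = f" "h \<Zsemi> (m \<Zsemi> Pr2 C r s) = g"
proof -
  have S: "S \<in> Sub C (r \<boxtimes> s)" and ob: "r \<in> Ob C" "s \<in> Ob C" using X by (auto simp: hom_Rel)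
  obtain n h where n: "n \<in> S" and h: "h \<in> hom C (Dom C f) (Dom C n)"
    and eq: "h \<Zsemi> (n \<Zsemi> Pr1 C r s) = f" "h \<Zsemi> (n \<Zsemi> Pr2 C r s) = g"
    using assms(2) by (auto simp: rel_holds_def)
  obtain i where i: "i \<in> hom C (Dom C n) (Dom C m)" "i \<Zsemi> m = n"
    using Sub_factor[OF S n m] by blast
  note mm = mem_hom_Rel[OF X m] and pr = Pr_hom[OF ob]
  show thesis
    by (rule that[OF comp_hom[OF h i(1)]])
      (use comp_assoc[OF h i(1) mm(3)] comp_assoc[OF h i(1) mm(4)] comp_assoc[OF i(1) mm(2) pr(1)]
        comp_assoc[OF i(1) mm(2) pr(2)] i(2) eq in simp_all)
qed

text \<open>A Yoneda argument: the two legs of a representative \<open>m\<close> of \<open>X\<close>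
  form the universal element of \<open>X\<close>, factored by the identity. That this element lies
  in \<open>Y\<close> is an inclusion of subobjects.\<close>

lemma Rel_leqI:
  assumes X: "X \<in> hom (Rel C) r s" and Y: "Y \<in> hom (Rel C) r s"
    and "\<And>f g. rel_holds C X f g \<Longrightarrow> rel_holds C Y f g"
  shows "X \<sqsubseteq>\<^bsub>Rel C\<^esub> Y"
proof -
  obtain S where XS: "X = (r, S, s)" and S: "S \<in> Sub C (r \<boxtimes> s)" and ob: "r \<in> Ob C" "s \<in> Ob C"
    using X by (auto simp: hom_Rel)
  obtain T where YT: "Y = (r, T, s)" using Y by (auto simp: hom_Rel)
  obtain m where m: "m \<in> S" using Sub_nonempty[OF S] by blast
  note mm = mem_hom_Rel[OF X[unfolded XS] m] and pr = Pr_hom[OF ob]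
  have d: "Dom C (m \<Zsemi> Pr1 C r s) = Dom C m" using mm(3) by (simp add: hom_def)
  have ob_m: "Dom C m \<in> Ob C" using hom_ob[OF mm(2)] by simp
  have "rel_holds C X (m \<Zsemi> Pr1 C r s) (m \<Zsemi> Pr2 C r s)"
    unfolding XS rel_holds_def using m d id_hom[OF ob_m] id_left[OF mm(3)] id_left[OF mm(4)] by auto
  from assms(3)[OF this] obtain n h where n: "n \<in> T" and h: "h \<in> hom C (Dom C m) (Dom C n)"
    and eq: "h \<Zsemi> (n \<Zsemi> Pr1 C r s) = m \<Zsemi> Pr1 C r s" "h \<Zsemi> (n \<Zsemi> Pr2 C r s) = m \<Zsemi> Pr2 C r s"
    unfolding YT rel_holds_def using d by auto
  note nn = mem_hom_Rel[OF Y[unfolded YT] n]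
  have "h \<Zsemi> n = m"
    by (rule product_ext[OF ob comp_hom[OF h nn(2)] mm(2)])
      (use eq comp_assoc[OF h nn(2) pr(1)] comp_assoc[OF h nn(2) pr(2)] in simp_all)
  then show ?thesis unfolding XS YT using m n h by (auto simp: sub_le_def)
qed

text \<open>The inclusion comes with its own representative \<open>m\<close>; once the element is
  factored through that \<open>m\<close>, composing with \<open>k\<close> moves it into
  \<open>Y\<close>.\<close>

lemma rel_holds_mono:
  assumes X: "X \<in> hom (Rel C) r s" and Y: "Y \<in> hom (Rel C) r s"
    and "X \<sqsubseteq>\<^bsub>Rel C\<^esub> Y" and "rel_holds C X f g"
  shows "rel_holds C Y f g"
proof -
  obtain S where XS: "X = (r, S, s)" and ob: "r \<in> Ob C" "s \<in> Ob C"
    using X by (auto simp: hom_Rel)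
  obtain T where YT: "Y = (r, T, s)" using Y by (auto simp: hom_Rel)
  obtain m n k where m: "m \<in> S" and n: "n \<in> T" and k: "k \<in> hom C (Dom C m) (Dom C n)" "k \<Zsemi> n = m"
    using assms(3) by (auto simp: XS YT sub_le_def)
  obtain h where h: "h \<in> hom C (Dom C f) (Dom C m)"
    "h \<Zsemi> (m \<Zsemi> Pr1 C r s) = f" "h \<Zsemi> (m \<Zsemi> Pr2 C r s) = g"
    using X[unfolded XS] assms(4)[unfolded XS] m by (rule rel_holdsE)
  note nn = mem_hom_Rel[OF Y[unfolded YT] n] and pr = Pr_hom[OF ob]
  have "h \<Zsemi> k \<Zsemi> (n \<Zsemi> Pr1 C r s) = f" "h \<Zsemi> k \<Zsemi> (n \<Zsemi> Pr2 C r s) = g"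
    using comp_assoc[OF h(1) k(1) nn(3)] comp_assoc[OF h(1) k(1) nn(4)] comp_assoc[OF k(1) nn(2) pr(1)]
      comp_assoc[OF k(1) nn(2) pr(2)] k(2) h(2,3) by simp_all
  then show ?thesis unfolding YT rel_holds_def using n comp_hom[OF h(1) k(1)] by auto
qed

section \<open>Graphs, composites and tensors on generalized elements\<close>

lemma graph_mono:
  assumes "f \<in> hom C a b"
  shows "is_mono C (tuple C (Id C a) f)"
proof -
  have ob: "a \<in> Ob C" "b \<in> Ob C" using hom_ob[OF assms] by auto
  note t = tuple[OF id_hom[OF ob(1)] assms]
  have "is_mono C (Id C a)" by (rule is_monoI[OF id_hom[OF ob(1)]]) (simp add: id_right)
  \<comment> \<open>The first projection is a retraction of the graph onto its source.\<close>
  then show ?thesis using is_mono_comp_cancel[OF t(1) Pr_hom(1)[OF ob]] t(2) by simp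
qed

lemma graph_hom:
  assumes "f \<in> hom C a b"
  shows "graph C f \<in> hom (Rel C) a b"
proof -
  have ob: "a \<in> Ob C" "b \<in> Ob C" using hom_ob[OF assms] by auto
  have "Dom C f = a" "Cod C f = b" "Cod C (tuple C (Id C a) f) = a \<boxtimes> b"
    using assms tuple(1)[OF id_hom[OF ob(1)] assms] by (simp_all add: hom_def)
  moreover have "sub_class C (tuple C (Id C a) f) \<in> Sub C (a \<boxtimes> b)"
    using graph_mono[OF assms] calculation(3) unfolding Sub_def by blast
  ultimately show ?thesis using ob by (simp add: hom_Rel graph_def)
qed

lemma rel_holds_graph:
  assumes "f \<in> hom C a b" "g \<in> hom C x a"
  shows "rel_holds C (graph C f) g (g \<Zsemi> f)"
proof -
  have ob: "a \<in> Ob C" "b \<in> Ob C" using hom_ob[OF assms(1)] by auto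
  define t where "t = tuple C (Id C a) f"
  note t = tuple[OF id_hom[OF ob(1)] assms(1), folded t_def]
  have "Dom C f = a" "Cod C f = b" "Dom C g = x" "Dom C t = a" using assms t by (simp_all add: hom_def)
  then show ?thesis
    using mem_sub_class_self[OF graph_mono[OF assms(1)], folded t_def] t(2,3) id_right[OF assms(2)] assms(2)
    by (simp add: rel_holds_def graph_def t_def[symmetric]) (metis t(2,3))
qed

text \<open>Assuming that \<open>rel_comp C X Y\<close> is a relation spares the construction of images: its subobject has
  a representative, and that representative is the image of some choice of pullback.\<close>

lemma rel_holds_comp:
  assumes X: "X \<in> hom (Rel C) r s" and Y: "Y \<in> hom (Rel C) s t" and XY: "rel_comp C X Y \<in> hom (Rel C) r t"
    and f: "rel_holds C X f g" and g: "rel_holds C Y g k"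
  shows "rel_holds C (rel_comp C X Y) f k"
proof -
  obtain S where XS: "X = (r, S, s)" and S: "S \<in> Sub C (r \<boxtimes> s)"
    and ob: "r \<in> Ob C" "s \<in> Ob C"
    using X by (auto simp: hom_Rel)
  obtain T where YT: "Y = (s, T, t)" and T: "T \<in> Sub C (s \<boxtimes> t)" and ob_t: "t \<in> Ob C"
    using Y by (auto simp: hom_Rel)
  obtain U where U: "rel_comp C X Y = (r, U, t)" "U \<in> Sub C (r \<boxtimes> t)"
    using XY by (auto simp: hom_Rel)
  obtain l where l: "l \<in> U" using Sub_nonempty[OF U(2)] by blast
  then obtain m n p q where m: "m \<in> S" and n: "n \<in> T"
    and pb: "is_pullback C p q (m \<Zsemi> Pr2 C r s) (n \<Zsemi> Pr1 C s t)"
    and li: "l \<in> image_sub C (tuple C (p \<Zsemi> (m \<Zsemi> Pr1 C r s)) (q \<Zsemi> (n \<Zsemi> Pr2 C s t)))"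
    using U(1) unfolding XS YT rel_comp_def by auto
  note mm = mem_hom_Rel[OF X[unfolded XS] m] and nn = mem_hom_Rel[OF Y[unfolded YT] n]
  note pr = Pr_hom[OF ob(1) ob_t]
  have d: "Dom C (m \<Zsemi> Pr2 C r s) = Dom C m" "Dom C (n \<Zsemi> Pr1 C s t) = Dom C n"
    using mm(4) nn(3) by (simp_all add: hom_def)
  have p: "p \<in> hom C (Dom C p) (Dom C m)" and q: "q \<in> hom C (Dom C p) (Dom C n)"
    using pb d by (simp_all add: is_pullback_def)
  obtain h where h: "h \<in> hom C (Dom C f) (Dom C m)"
    "h \<Zsemi> (m \<Zsemi> Pr1 C r s) = f" "h \<Zsemi> (m \<Zsemi> Pr2 C r s) = g"
    using X[unfolded XS] f[unfolded XS] m by (rule rel_holdsE)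
  have "Dom C g = Dom C f" using rel_holds_hom(2)[OF X f] by (simp add: hom_def)
  then obtain h' where h': "h' \<in> hom C (Dom C f) (Dom C n)"
    "h' \<Zsemi> (n \<Zsemi> Pr1 C s t) = g" "h' \<Zsemi> (n \<Zsemi> Pr2 C s t) = k"
    using Y[unfolded YT] g[unfolded YT] n by (metis rel_holdsE)
  \<comment> \<open>\<open>h\<close> and \<open>h'\<close> both give \<open>g\<close> over the
    middle object, so they induce an element of the pullback.\<close>
  obtain u where u: "u \<in> hom C (Dom C f) (Dom C p)" "u \<Zsemi> p = h" "u \<Zsemi> q = h'"
    using pb h h' unfolding is_pullback_def d by metis
  note pm = comp_hom[OF p mm(3)] and qn = comp_hom[OF q nn(4)]
  note tup = tuple[OF pm qn]
  \<comment> \<open>The epi part of the image factorization carries elements of the pullback into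
    the image.\<close>
  obtain e where e: "e \<in> hom C (Dom C p) (Dom C l)"
    "e \<Zsemi> l = tuple C (p \<Zsemi> (m \<Zsemi> Pr1 C r s)) (q \<Zsemi> (n \<Zsemi> Pr2 C s t))"
    and ll: "l \<in> hom C (Dom C l) (r \<boxtimes> t)"
    using li tup(1) by (rule image_subD)
  have "e \<Zsemi> (l \<Zsemi> Pr1 C r t) = p \<Zsemi> (m \<Zsemi> Pr1 C r s)" "e \<Zsemi> (l \<Zsemi> Pr2 C r t) = q \<Zsemi> (n \<Zsemi> Pr2 C s t)"
    using comp_assoc[OF e(1) ll pr(1)] comp_assoc[OF e(1) ll pr(2)] e(2) tup(2,3) by simp_all
  then have "u \<Zsemi> e \<Zsemi> (l \<Zsemi> Pr1 C r t) = f" "u \<Zsemi> e \<Zsemi> (l \<Zsemi> Pr2 C r t) = k"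
    using comp_assoc[OF u(1) e(1) comp_hom[OF ll pr(1)]] comp_assoc[OF u(1) e(1) comp_hom[OF ll pr(2)]]
      comp_assoc[OF u(1) p mm(3)] comp_assoc[OF u(1) q nn(4)] u(2,3) h(2) h'(3) by simp_all
  then show ?thesis unfolding U rel_holds_def using l comp_hom[OF u(1) e(1)] by auto
qed

text \<open>As with composition, the assumption that the tensor is a relation provides a
  representative \<open>l\<close>. It is isomorphic to the product map \<open>M\<close>, through
  which the pair of the two given factorizations passes.\<close>

lemma rel_holds_ten:
  assumes X: "X \<in> hom (Rel C) r1 s1" and Y: "Y \<in> hom (Rel C) r2 s2"
    and XY: "rel_ten C X Y \<in> hom (Rel C) (r1 \<boxtimes> r2) (s1 \<boxtimes> s2)"
    and f: "rel_holds C X f1 g1" and g: "rel_holds C Y f2 g2" and dom: "Dom C f1 = Dom C f2"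
  shows "rel_holds C (rel_ten C X Y) (tuple C f1 f2) (tuple C g1 g2)"
proof -
  obtain S where XS: "X = (r1, S, s1)" and ob1: "r1 \<in> Ob C" "s1 \<in> Ob C"
    using X by (auto simp: hom_Rel)
  obtain T where YT: "Y = (r2, T, s2)" and ob2: "r2 \<in> Ob C" "s2 \<in> Ob C"
    using Y by (auto simp: hom_Rel)
  obtain U where U: "rel_ten C X Y = (r1 \<boxtimes> r2, U, s1 \<boxtimes> s2)" "U \<in> Sub C ((r1 \<boxtimes> r2) \<boxtimes> (s1 \<boxtimes> s2))"
    and ob: "r1 \<boxtimes> r2 \<in> Ob C" "s1 \<boxtimes> s2 \<in> Ob C"
    using XY by (auto simp: hom_Rel)
  obtain l where l: "l \<in> U" using Sub_nonempty[OF U(2)] by blast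
  then obtain m n where m: "m \<in> S" and n: "n \<in> T"
    and li: "l \<in> sub_class C (rel_ten_map C r1 s1 m r2 s2 n)"
    using U(1) unfolding XS YT rel_ten_def by auto
  note mm = mem_hom_Rel[OF X[unfolded XS] m] and nn = mem_hom_Rel[OF Y[unfolded YT] n]
  have ob_mn: "Dom C m \<in> Ob C" "Dom C n \<in> Ob C" using hom_ob mm(2) nn(2) by blast+
  define p where "p = Pr1 C (Dom C m) (Dom C n)"
  define q where "q = Pr2 C (Dom C m) (Dom C n)"
  note pq = Pr_hom[OF ob_mn, folded p_def q_def]
  define t1 where "t1 = tuple C (p \<Zsemi> (m \<Zsemi> Pr1 C r1 s1)) (q \<Zsemi> (n \<Zsemi> Pr1 C r2 s2))"
  define t2 where "t2 = tuple C (p \<Zsemi> (m \<Zsemi> Pr2 C r1 s1)) (q \<Zsemi> (n \<Zsemi> Pr2 C r2 s2))"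
  define M where "M = tuple C t1 t2"
  have M_eq: "rel_ten_map C r1 s1 m r2 s2 n = M"
    by (simp add: rel_ten_map_def Let_def M_def t1_def t2_def p_def q_def)
  note t1 = tuple[OF comp_hom[OF pq(1) mm(3)] comp_hom[OF pq(2) nn(3)], folded t1_def]
  note t2 = tuple[OF comp_hom[OF pq(1) mm(4)] comp_hom[OF pq(2) nn(4)], folded t2_def]
  note M = tuple[OF t1(1) t2(1), folded M_def] and pr = Pr_hom[OF ob]
  have "Dom C M = Dom C m \<boxtimes> Dom C n" "Cod C M = (r1 \<boxtimes> r2) \<boxtimes> (s1 \<boxtimes> s2)"
    using M(1) by (simp_all add: hom_def)
  then obtain i where i: "i \<in> hom C (Dom C l) (Dom C m \<boxtimes> Dom C n)" "is_iso C i" "i \<Zsemi> M = l"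
    using li by (auto simp: M_eq sub_class_def)
  note ll = Sub_memD(2)[OF U(2) l]
  obtain j where j: "j \<in> hom C (Dom C m \<boxtimes> Dom C n) (Dom C l)" "j \<Zsemi> i = Id C (Dom C m \<boxtimes> Dom C n)"
    using i(2,1) by (rule is_isoE)
  \<comment> \<open>The class gives \<open>l\<close> as a composite through \<open>M\<close>; an
    element of \<open>M\<close> becomes one of \<open>l\<close> along the inverse
    \<open>j\<close>.\<close>
  have jl: "j \<Zsemi> l = M" using comp_assoc[OF j(1) i(1) M(1)] j(2) i(3) id_left[OF M(1)] by simp
  obtain h where h: "h \<in> hom C (Dom C f1) (Dom C m)"
    "h \<Zsemi> (m \<Zsemi> Pr1 C r1 s1) = f1" "h \<Zsemi> (m \<Zsemi> Pr2 C r1 s1) = g1"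
    using X[unfolded XS] f[unfolded XS] m by (rule rel_holdsE)
  obtain h' where h': "h' \<in> hom C (Dom C f1) (Dom C n)"
    "h' \<Zsemi> (n \<Zsemi> Pr1 C r2 s2) = f2" "h' \<Zsemi> (n \<Zsemi> Pr2 C r2 s2) = g2"
    unfolding dom using Y[unfolded YT] g[unfolded YT] n by (rule rel_holdsE)
  define w where "w = tuple C h h'"
  note w = tuple[OF h(1) h'(1), folded w_def p_def q_def]
  have wt: "w \<Zsemi> t1 = tuple C f1 f2" "w \<Zsemi> t2 = tuple C g1 g2"
    unfolding t1_def t2_def
      comp_tuple[OF w(1) comp_hom[OF pq(1) mm(3)] comp_hom[OF pq(2) nn(3)]]
      comp_tuple[OF w(1) comp_hom[OF pq(1) mm(4)] comp_hom[OF pq(2) nn(4)]]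
    using comp_assoc[OF w(1) pq(1) mm(3)] comp_assoc[OF w(1) pq(1) mm(4)] comp_assoc[OF w(1) pq(2) nn(3)]
      comp_assoc[OF w(1) pq(2) nn(4)] w(2,3) h(2,3) h'(2,3) by simp_all
  have jl_pr: "j \<Zsemi> (l \<Zsemi> Pr1 C (r1 \<boxtimes> r2) (s1 \<boxtimes> s2)) = t1" "j \<Zsemi> (l \<Zsemi> Pr2 C (r1 \<boxtimes> r2) (s1 \<boxtimes> s2)) = t2"
    using comp_assoc[OF j(1) ll pr(1)] comp_assoc[OF j(1) ll pr(2)] jl M(2,3) by simp_all
  have eqs: "w \<Zsemi> j \<Zsemi> (l \<Zsemi> Pr1 C (r1 \<boxtimes> r2) (s1 \<boxtimes> s2)) = tuple C f1 f2"
    "w \<Zsemi> j \<Zsemi> (l \<Zsemi> Pr2 C (r1 \<boxtimes> r2) (s1 \<boxtimes> s2)) = tuple C g1 g2"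
    using comp_assoc[OF w(1) j(1) comp_hom[OF ll pr(1)]] comp_assoc[OF w(1) j(1) comp_hom[OF ll pr(2)]]
      jl_pr wt by simp_all
  have "tuple C f1 f2 \<in> hom C (Dom C f1) (r1 \<boxtimes> r2)"
    using comp_hom[OF w(1) t1(1)] wt(1) by simp
  then have "Dom C (tuple C f1 f2) = Dom C f1" by (simp add: hom_def)
  then show ?thesis unfolding U rel_holds_def using l comp_hom[OF w(1) j(1)] eqs by auto
qed

end

section \<open>The functor represented by the unit\<close>

context sym_mon_pocat
begin

text \<open>The doubling map of the unit object, which turns two arrows out of \<open>Unit C\<close>
  into one; composed with \<open>x \<otimes> y\<close> it gives the laxator.\<close>

abbreviation (input) unit_split :: 'a where
  "unit_split \<equiv> inverse_arr C (LUnit C (Unit C))"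

lemma unit_split:
  "unit_split \<in> hom C (Unit C) (Unit C \<odot> Unit C)"
  "LUnit C (Unit C) \<Zsemi> unit_split = Id C (Unit C \<odot> Unit C)"
  "unit_split \<Zsemi> LUnit C (Unit C) = Id C (Unit C)"
  using inverse_arr[OF lunit_iso[OF unit_ob] lunit_hom[OF unit_ob]] by simp_all

lemma pairing_hom:
  assumes "x \<in> hom C (Unit C) a" "y \<in> hom C (Unit C) b"
  shows "unit_split \<Zsemi> (x \<otimes> y) \<in> hom C (Unit C) (a \<odot> b)"
  using comp_hom[OF unit_split(1) ten_hom[OF assms]] .

text \<open>Interchange of tensor and composition; this is the naturality square of the
  laxator.\<close>

lemma pairing_comp:
  assumes "x \<in> hom C (Unit C) a" "y \<in> hom C (Unit C) b" "f \<in> hom C a a'" "g \<in> hom C b b'"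
  shows "unit_split \<Zsemi> ((x \<Zsemi> f) \<otimes> (y \<Zsemi> g)) = unit_split \<Zsemi> (x \<otimes> y) \<Zsemi> (f \<otimes> g)"
  using ten_comp[OF assms(1,3,2,4)]
    comp_assoc[OF unit_split(1) ten_hom[OF assms(1,2)] ten_hom[OF assms(3,4)]] by simp

lemma pairing_mono:
  assumes "x \<in> hom C (Unit C) a" "x' \<in> hom C (Unit C) a" "y \<in> hom C (Unit C) b" "y' \<in> hom C (Unit C) b"
    and "x \<sqsubseteq> x'" "y \<sqsubseteq> y'"
  shows "unit_split \<Zsemi> (x \<otimes> y) \<sqsubseteq> unit_split \<Zsemi> (x' \<otimes> y')"
  by (rule comp_mono[OF unit_split(1) unit_split(1) ten_hom[OF assms(1,3)] ten_hom[OF assms(2,4)]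
        leq_refl[OF unit_split(1)] ten_mono[OF assms]])

text \<open>Naturality moves the unitor to the unit object, where \<open>unit_split\<close> cancels
  it.\<close>

lemma pairing_lunit:
  assumes "x \<in> hom C (Unit C) a"
  shows "unit_split \<Zsemi> (Id C (Unit C) \<otimes> x) \<Zsemi> LUnit C a = x"
proof -
  have a: "a \<in> Ob C" using hom_ob[OF assms] by simp
  have "unit_split \<Zsemi> (Id C (Unit C) \<otimes> x) \<Zsemi> LUnit C a = unit_split \<Zsemi> (LUnit C (Unit C) \<Zsemi> x)"
    using comp_assoc[OF unit_split(1) ten_hom[OF id_hom[OF unit_ob] assms] lunit_hom[OF a]]
      lunit_nat[OF assms] by simp
  also have "\<dots> = x"
    using comp_assoc[OF unit_split(1) lunit_hom[OF unit_ob] assms] unit_split(3) id_left[OF assms] by simp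
  finally show ?thesis .
qed

text \<open>Since the two unitors agree at the unit object, \<open>unit_split\<close> cancels the
  right one as well.\<close>

lemma pairing_runit:
  assumes "x \<in> hom C (Unit C) a" and "LUnit C (Unit C) = RUnit C (Unit C)"
  shows "unit_split \<Zsemi> (x \<otimes> Id C (Unit C)) \<Zsemi> RUnit C a = x"
proof -
  have a: "a \<in> Ob C" using hom_ob[OF assms(1)] by simp
  have "unit_split \<Zsemi> (x \<otimes> Id C (Unit C)) \<Zsemi> RUnit C a = unit_split \<Zsemi> (LUnit C (Unit C) \<Zsemi> x)"
    using comp_assoc[OF unit_split(1) ten_hom[OF assms(1) id_hom[OF unit_ob]] runit_hom[OF a]]
      runit_nat[OF assms(1)] assms(2) by simp
  also have "\<dots> = x"
    using comp_assoc[OF unit_split(1) lunit_hom[OF unit_ob] assms(1)] unit_split(3) id_left[OF assms(1)]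
    by simp
  finally show ?thesis .
qed

text \<open>Naturality moves the symmetry to the unit object, where it is the identity.\<close>

lemma pairing_swap:
  assumes "x \<in> hom C (Unit C) a" "y \<in> hom C (Unit C) b"
    and "Swap C (Unit C) (Unit C) = Id C (Unit C \<odot> Unit C)"
  shows "unit_split \<Zsemi> (x \<otimes> y) \<Zsemi> Swap C a b = unit_split \<Zsemi> (y \<otimes> x)"
proof -
  have ob: "a \<in> Ob C" "b \<in> Ob C" using hom_ob assms by auto
  show ?thesis
    using comp_assoc[OF unit_split(1) ten_hom[OF assms(1,2)] swap_hom[OF ob]] swap_nat[OF assms(1,2)]
      assms(3) id_left[OF ten_hom[OF assms(2,1)]] by simp
qed

text \<open>The triangle law at the unit \<open>I\<close>, where the unitors agree, shows that the
  left side followed by \<open>Id C I \<otimes> LUnit C I\<close> is the identity. Composing with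
  \<open>Id C I \<otimes> unit_split\<close>, the inverse of that last factor, gives the
  claim.\<close>

lemma unit_split_assoc:
  assumes "LUnit C (Unit C) = RUnit C (Unit C)"
  defines "I \<equiv> Unit C"
  shows "(unit_split \<otimes> Id C I) \<Zsemi> Assoc C I I I = Id C I \<otimes> unit_split"
proof -
  have I: "I \<in> Ob C" "Id C I \<in> hom C I I" "I \<odot> I \<in> Ob C"
    using unit_ob id_hom ten_ob by (simp_all add: I_def)
  note u = unit_split[folded I_def]
  have l: "LUnit C I \<in> hom C (I \<odot> I) I" using lunit_hom[OF I(1)] by (simp add: I_def)
  note A = assoc_hom[OF I(1) I(1) I(1)]
  note lI = ten_hom[OF I(2) l] and uI = ten_hom[OF u(1) I(2)] and Iu = ten_hom[OF I(2) u(1)]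
  note uA = comp_hom[OF uI A]
  have "(unit_split \<otimes> Id C I) \<Zsemi> Assoc C I I I \<Zsemi> (Id C I \<otimes> LUnit C I)
      = (unit_split \<otimes> Id C I) \<Zsemi> (LUnit C I \<otimes> Id C I)"
    using comp_assoc[OF uI A lI] triangle[OF I(1) I(1)] assms(1) by (simp add: I_def)
  also have "\<dots> = Id C (I \<odot> I)"
    using ten_comp[OF u(1) l I(2) I(2)] u(3) id_left[OF I(2)] ten_id[OF I(1) I(1)] by (simp add: I_def)
  finally have "(unit_split \<otimes> Id C I) \<Zsemi> Assoc C I I I \<Zsemi> ((Id C I \<otimes> LUnit C I) \<Zsemi> (Id C I \<otimes> unit_split))
      = Id C I \<otimes> unit_split"
    using comp_assoc[OF uA lI Iu] id_left[OF Iu] by (simp add: I_def)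
  moreover have "(Id C I \<otimes> LUnit C I) \<Zsemi> (Id C I \<otimes> unit_split) = Id C (I \<odot> (I \<odot> I))"
    using ten_comp[OF I(2) I(2) l u(1)] u(2) id_left[OF I(2)] ten_id[OF I(1) I(3)] by (simp add: I_def)
  ultimately show ?thesis using id_right[OF uA] by (simp add: I_def)
qed

text \<open>Naturality of the associator reduces the law to its instance at the unit object, which
  is \<open>unit_split_assoc\<close>.\<close>

lemma pairing_assoc:
  assumes "x \<in> hom C (Unit C) a" "y \<in> hom C (Unit C) b" "z \<in> hom C (Unit C) c"
    and "LUnit C (Unit C) = RUnit C (Unit C)"
  shows "unit_split \<Zsemi> ((unit_split \<Zsemi> (x \<otimes> y)) \<otimes> z) \<Zsemi> Assoc C a b c
    = unit_split \<Zsemi> (x \<otimes> (unit_split \<Zsemi> (y \<otimes> z)))"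
proof -
  define I where "I = Unit C"
  have I: "I \<in> Ob C" "Id C I \<in> hom C I I" using unit_ob id_hom by (simp_all add: I_def)
  have ob: "a \<in> Ob C" "b \<in> Ob C" "c \<in> Ob C" using hom_ob assms by auto
  note x = assms(1)[folded I_def] and y = assms(2)[folded I_def] and z = assms(3)[folded I_def]
  note u = unit_split[folded I_def]
  note A = assoc_hom[OF I(1) I(1) I(1)] and A' = assoc_hom[OF ob]
  note uI = ten_hom[OF u(1) I(2)] and Iu = ten_hom[OF I(2) u(1)]
  note xyz = ten_hom[OF ten_hom[OF x y] z] and xyz' = ten_hom[OF x ten_hom[OF y z]]
  note uxyz = ten_hom[OF comp_hom[OF u(1) ten_hom[OF x y]] z]
  have "((unit_split \<Zsemi> (x \<otimes> y)) \<otimes> z) \<Zsemi> Assoc C a b c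
      = (unit_split \<otimes> Id C I) \<Zsemi> ((x \<otimes> y) \<otimes> z) \<Zsemi> Assoc C a b c"
    using ten_comp[OF u(1) ten_hom[OF x y] I(2) z] id_left[OF z] by (simp add: I_def)
  also have "\<dots> = (unit_split \<otimes> Id C I) \<Zsemi> Assoc C I I I \<Zsemi> (x \<otimes> (y \<otimes> z))"
    using comp_assoc[OF uI xyz A'] assoc_nat[OF x y z] comp_assoc[OF uI A xyz'] by (simp add: I_def)
  also have "\<dots> = (Id C I \<otimes> unit_split) \<Zsemi> (x \<otimes> (y \<otimes> z))"
    using unit_split_assoc[OF assms(4)] by (simp add: I_def)
  also have "\<dots> = x \<otimes> (unit_split \<Zsemi> (y \<otimes> z))"
    using ten_comp[OF I(2) x u(1) ten_hom[OF y z]] id_left[OF x] by (simp add: I_def)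
  finally show ?thesis using comp_assoc[OF u(1) uxyz A'] by (simp add: I_def)
qed

text \<open>Discarding the second factor turns \<open>y\<close> into the endomorphism
  \<open>y \<Zsemi> e\<close> of the unit. This lies below the identity, and replacing it by the
  identity leaves the right unit law for \<open>x\<close>.\<close>

lemma pairing_discard_right:
  assumes "\<And>t. t \<in> hom C (Unit C) (Unit C) \<Longrightarrow> t \<sqsubseteq> Id C (Unit C)"
    and "LUnit C (Unit C) = RUnit C (Unit C)"
    and "x \<in> hom C (Unit C) a" "y \<in> hom C (Unit C) b" "e \<in> hom C b (Unit C)"
  shows "unit_split \<Zsemi> (x \<otimes> y) \<Zsemi> ((Id C a \<otimes> e) \<Zsemi> RUnit C a) \<sqsubseteq> x"
proof -
  have ob: "a \<in> Ob C" "b \<in> Ob C" using hom_ob assms by auto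
  note x = assms(3) and y = assms(4) and e = assms(5)
  note I = id_hom[OF unit_ob] and xy = pairing_hom[OF x y] and r = runit_hom[OF ob(1)]
  have "unit_split \<Zsemi> (x \<otimes> y) \<Zsemi> ((Id C a \<otimes> e) \<Zsemi> RUnit C a)
      = unit_split \<Zsemi> (x \<otimes> (y \<Zsemi> e)) \<Zsemi> RUnit C a"
    using comp_assoc[OF xy ten_hom[OF id_hom[OF ob(1)] e] r]
      pairing_comp[OF x y id_hom[OF ob(1)] e] id_right[OF x] by simp
  also have "\<dots> \<sqsubseteq> unit_split \<Zsemi> (x \<otimes> Id C (Unit C)) \<Zsemi> RUnit C a"
    using comp_mono[OF pairing_hom[OF x comp_hom[OF y e]] pairing_hom[OF x I] r r
        pairing_mono[OF x x comp_hom[OF y e] I leq_refl[OF x] assms(1)[OF comp_hom[OF y e]]]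
        leq_refl[OF r]] .
  finally show ?thesis using pairing_runit[OF x assms(2)] by simp
qed

lemma pairing_discard_left:
  assumes "\<And>t. t \<in> hom C (Unit C) (Unit C) \<Longrightarrow> t \<sqsubseteq> Id C (Unit C)"
    and "x \<in> hom C (Unit C) a" "y \<in> hom C (Unit C) b" "e \<in> hom C a (Unit C)"
  shows "unit_split \<Zsemi> (x \<otimes> y) \<Zsemi> ((e \<otimes> Id C b) \<Zsemi> LUnit C b) \<sqsubseteq> y"
proof -
  have ob: "a \<in> Ob C" "b \<in> Ob C" using hom_ob assms by auto
  note x = assms(2) and y = assms(3) and e = assms(4)
  note I = id_hom[OF unit_ob] and xy = pairing_hom[OF x y] and r = lunit_hom[OF ob(2)]
  have "unit_split \<Zsemi> (x \<otimes> y) \<Zsemi> ((e \<otimes> Id C b) \<Zsemi> LUnit C b)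
      = unit_split \<Zsemi> ((x \<Zsemi> e) \<otimes> y) \<Zsemi> LUnit C b"
    using comp_assoc[OF xy ten_hom[OF e id_hom[OF ob(2)]] r]
      pairing_comp[OF x y e id_hom[OF ob(2)]] id_right[OF y] by simp
  also have "\<dots> \<sqsubseteq> unit_split \<Zsemi> (Id C (Unit C) \<otimes> y) \<Zsemi> LUnit C b"
    using comp_mono[OF pairing_hom[OF comp_hom[OF x e] y] pairing_hom[OF I y] r r
        pairing_mono[OF comp_hom[OF x e] I y y assms(1)[OF comp_hom[OF x e]] leq_refl[OF y]]
        leq_refl[OF r]] .
  finally show ?thesis using pairing_lunit[OF y] by simp
qed

section \<open>The posets of arrows out of the unit and the functor that they form\<close>

lemma hom_poset_iff [simp]:
  "(Atom x, Atom y) \<in> hom_poset C r \<longleftrightarrow> x \<in> hom C (Unit C) r \<and> y \<in> hom C (Unit C) r \<and> x \<sqsubseteq> y"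
  by (auto simp: hom_poset_def)

lemma Field_hom_poset: "Field (hom_poset C r) = Atom ` hom C (Unit C) r"
proof -
  have "Atom x \<in> Field (hom_poset C r)" if "x \<in> hom C (Unit C) r" for x
    using that leq_refl[OF that] by (intro FieldI1[of _ "Atom x"]) simp
  moreover have "Field (hom_poset C r) \<subseteq> Atom ` hom C (Unit C) r"
    by (auto simp: hom_poset_def Field_def)
  ultimately show ?thesis by blast
qed

lemma mem_Field_hom_poset: "x \<in> Field (hom_poset C r) \<longleftrightarrow> (\<exists>f. x = Atom f \<and> f \<in> hom C (Unit C) r)"
  by (auto simp: Field_hom_poset)

lemma ball_Field_hom_poset:
  "(\<forall>x\<in>Field (hom_poset C r). P x) \<longleftrightarrow> (\<forall>f\<in>hom C (Unit C) r. P (Atom f))"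
  by (simp add: Field_hom_poset)

lemma Partial_order_hom_poset: "Partial_order (hom_poset C r)"
  unfolding partial_order_on_def preorder_on_def
proof (intro conjI)
  show "refl_on (Field (hom_poset C r)) (hom_poset C r)"
    unfolding Field_hom_poset using leq_refl by (auto simp: refl_on_def)
  show "trans (hom_poset C r)"
    by (rule transI) (clarsimp simp: hom_poset_def, rule leq_trans)
  show "antisym (hom_poset C r)"
    by (rule antisymI) (clarsimp simp: hom_poset_def, rule leq_antisym)
  show "hom_poset C r \<subseteq> Field (hom_poset C r) \<times> Field (hom_poset C r)"
    by (auto intro: FieldI1 FieldI2)
qed

lemma hom_unit_ArrMap:
  "f \<in> hom C a b \<Longrightarrow>
    ArrMap (hom_unit C) f = poset_map (hom_poset C a) (\<lambda>x. Atom (unAtom x \<Zsemi> f)) (hom_poset C b)"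
  by (auto simp: hom_unit_def hom_def)

lemma hom_unit_ObMap: "ObMap (hom_unit C) = hom_poset C"
  by (simp add: hom_unit_def)

lemma poset_hom_post_comp:
  "f \<in> hom C a b \<Longrightarrow> poset_hom (hom_poset C a) (hom_poset C b) (\<lambda>x. Atom (unAtom x \<Zsemi> f))"
  by (auto simp: poset_hom_def hom_poset_def intro: comp_hom)
    (metis comp_mono leq_refl)

lemma poset_hom_pairing:
  "poset_hom (prod_poset (hom_poset C a) (hom_poset C b)) (hom_poset C (a \<odot> b))
     (\<lambda>z. Atom (unit_split \<Zsemi> (unAtom (left z) \<otimes> unAtom (right z))))"
  unfolding poset_hom_def
proof (intro allI impI)
  fix p q assume "(p, q) \<in> prod_poset (hom_poset C a) (hom_poset C b)"
  then obtain x x' y y' where p: "p = Couple (Atom x) (Atom y)" "q = Couple (Atom x') (Atom y')"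
    and xy: "x \<in> hom C (Unit C) a" "x' \<in> hom C (Unit C) a" "x \<sqsubseteq> x'"
      "y \<in> hom C (Unit C) b" "y' \<in> hom C (Unit C) b" "y \<sqsubseteq> y'"
    by (auto simp: prod_poset_def hom_poset_def)
  then show "(Atom (unit_split \<Zsemi> (unAtom (left p) \<otimes> unAtom (right p))),
      Atom (unit_split \<Zsemi> (unAtom (left q) \<otimes> unAtom (right q)))) \<in> hom_poset C (a \<odot> b)"
    using pairing_hom pairing_mono by simp
qed

lemma poset_hom_unit: "poset_hom unit_poset (hom_poset C (Unit C)) (\<lambda>_. Atom (Id C (Unit C)))"
  using id_hom[OF unit_ob] leq_refl by (simp add: poset_hom_iff ball_unit_poset)

lemma po_functor_hom_unit: "po_functor C Poset (hom_unit C)"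
proof
  fix a assume "a \<in> Ob C"
  then show "ObMap (hom_unit C) a \<in> Ob Poset"
    "ArrMap (hom_unit C) (Id C a) = Id Poset (ObMap (hom_unit C) a)"
    by (auto simp: hom_unit_ObMap Partial_order_hom_poset hom_unit_ArrMap[OF id_hom] ball_Field_hom_poset
        poset_map_eq_iff id_right)
next
  fix f a b assume f: "f \<in> hom C a b"
  show "ArrMap (hom_unit C) f \<in> hom Poset (ObMap (hom_unit C) a) (ObMap (hom_unit C) b)"
    unfolding hom_unit_ArrMap[OF f] hom_unit_ObMap
    by (intro poset_map_hom Partial_order_hom_poset poset_hom_post_comp f)
next
  fix f g a b c assume f: "f \<in> hom C a b" and g: "g \<in> hom C b c"
  show "ArrMap (hom_unit C) (f \<Zsemi> g) = ArrMap (hom_unit C) f \<Zsemi>\<^bsub>Poset\<^esub> ArrMap (hom_unit C) g"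
    using f g comp_assoc[OF _ f g]
    by (simp add: hom_unit_ArrMap[OF f] hom_unit_ArrMap[OF g] hom_unit_ArrMap[OF comp_hom[OF f g]]
        poset_map_comp Partial_order_hom_poset poset_hom_post_comp poset_map_eq_iff ball_Field_hom_poset)
next
  fix f g a b assume fg: "f \<in> hom C a b" "g \<in> hom C a b" "f \<sqsubseteq> g"
  then show "ArrMap (hom_unit C) f \<sqsubseteq>\<^bsub>Poset\<^esub> ArrMap (hom_unit C) g"
    using comp_hom[OF _ fg(1)] comp_hom[OF _ fg(2)] comp_mono[OF _ _ fg(1,2) leq_refl]
    by (simp add: hom_unit_ArrMap[OF fg(1)] hom_unit_ArrMap[OF fg(2)] poset_map_leq
        Partial_order_hom_poset ball_Field_hom_poset)
qed

text \<open>In contrast to \<open>poset_calc\<close>, \<open>poset_hom\<close> stays folded: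
  monotonicity of pairing is not a matter of computation and enters as a fact.\<close>

lemmas hom_poset_calc = poset_map_comp poset_map_ten poset_map_eq_iff Partial_orders
  Partial_order_hom_poset ball_Field_prod_poset ball_Field_unit_poset ball_Field_hom_poset
  poset_hom_id poset_hom_ten hom_unit_ObMap

text \<open>On elements, each law of a lax symmetric monoidal functor becomes the corresponding law
  of pairing.\<close>

lemma lax_sym_mon_pofunctor_hom_unit:
  assumes LR: "LUnit C (Unit C) = RUnit C (Unit C)"
    and S: "Swap C (Unit C) (Unit C) = Id C (Unit C \<odot> Unit C)"
  shows "lax_sym_mon_pofunctor C Poset (hom_unit C) (hom_unit_laxator0 C) (hom_unit_laxator C)"
proof -
  interpret P: sym_mon_pocat "Poset :: ('a poset, 'a poset_arr) smpocat" by (rule sym_mon_pocat_Poset)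
  interpret F: po_functor C Poset "hom_unit C" by (rule po_functor_hom_unit)
  note rho = hom_unit_laxator_def and rho0 = hom_unit_laxator0_def
  show ?thesis
  proof
    show "hom_unit_laxator0 C \<in> hom Poset (Unit Poset) (ObMap (hom_unit C) (Unit C))"
      by (simp add: rho0 hom_unit_ObMap poset_map_hom Partial_orders Partial_order_hom_poset poset_hom_unit)
  next
    fix a b
    show "hom_unit_laxator C a b \<in> hom Poset (ObMap (hom_unit C) a \<odot>\<^bsub>Poset\<^esub> ObMap (hom_unit C) b)
        (ObMap (hom_unit C) (a \<odot> b))"
      by (simp add: rho hom_unit_ObMap poset_map_hom Partial_orders Partial_order_hom_poset poset_hom_pairing)
    assume ob: "a \<in> Ob C" "b \<in> Ob C"
    show "hom_unit_laxator C a b \<Zsemi>\<^bsub>Poset\<^esub> ArrMap (hom_unit C) (Swap C a b)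
      = Swap Poset (ObMap (hom_unit C) a) (ObMap (hom_unit C) b) \<Zsemi>\<^bsub>Poset\<^esub> hom_unit_laxator C b a"
      unfolding hom_unit_ArrMap[OF swap_hom[OF ob]] rho
      by (simp add: hom_poset_calc poset_hom_pairing poset_hom_structure pairing_swap[OF _ _ S])
  next
    fix f g a a' b b' assume f: "f \<in> hom C a a'" and g: "g \<in> hom C b b'"
    show "(ArrMap (hom_unit C) f \<otimes>\<^bsub>Poset\<^esub> ArrMap (hom_unit C) g) \<Zsemi>\<^bsub>Poset\<^esub> hom_unit_laxator C a' b'
        = hom_unit_laxator C a b \<Zsemi>\<^bsub>Poset\<^esub> ArrMap (hom_unit C) (f \<otimes> g)"
      unfolding hom_unit_ArrMap[OF f] hom_unit_ArrMap[OF g] hom_unit_ArrMap[OF ten_hom[OF f g]] rho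
      using poset_hom_ten[OF poset_hom_post_comp[OF f] poset_hom_post_comp[OF g]]
      by (simp add: hom_poset_calc poset_hom_pairing pairing_comp[OF _ _ f g])
  next
    fix a b c assume ob: "a \<in> Ob C" "b \<in> Ob C" "c \<in> Ob C"
    show "(hom_unit_laxator C a b \<otimes>\<^bsub>Poset\<^esub> Id Poset (ObMap (hom_unit C) c))
          \<Zsemi>\<^bsub>Poset\<^esub> hom_unit_laxator C (a \<odot> b) c \<Zsemi>\<^bsub>Poset\<^esub> ArrMap (hom_unit C) (Assoc C a b c)
        = Assoc Poset (ObMap (hom_unit C) a) (ObMap (hom_unit C) b) (ObMap (hom_unit C) c)
          \<Zsemi>\<^bsub>Poset\<^esub> (Id Poset (ObMap (hom_unit C) a) \<otimes>\<^bsub>Poset\<^esub> hom_unit_laxator C b c)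
          \<Zsemi>\<^bsub>Poset\<^esub> hom_unit_laxator C a (b \<odot> c)"
      unfolding hom_unit_ArrMap[OF assoc_hom[OF ob]] rho
      \<comment> \<open>\<open>poset_map_comp\<close> needs the first factor to be monotone.
        Composites nest to the left, so this must be known of their initial segments.\<close>
      using poset_hom_ten[OF poset_hom_pairing poset_hom_id, of a b "hom_poset C c"]
        poset_hom_comp[OF poset_hom_ten[OF poset_hom_pairing poset_hom_id] poset_hom_pairing, of a b c]
        poset_hom_comp[OF poset_hom_structure(1) poset_hom_ten[OF poset_hom_id poset_hom_pairing],
          of "hom_poset C a" b c]
      by (simp add: hom_poset_calc poset_hom_structure pairing_assoc[OF _ _ _ LR])
  next
    fix a assume ob: "a \<in> Ob C"
    show "(hom_unit_laxator0 C \<otimes>\<^bsub>Poset\<^esub> Id Poset (ObMap (hom_unit C) a))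
          \<Zsemi>\<^bsub>Poset\<^esub> hom_unit_laxator C (Unit C) a \<Zsemi>\<^bsub>Poset\<^esub> ArrMap (hom_unit C) (LUnit C a)
        = LUnit Poset (ObMap (hom_unit C) a)"
      unfolding hom_unit_ArrMap[OF lunit_hom[OF ob]] rho rho0
      using poset_hom_ten[OF poset_hom_unit poset_hom_id, of "hom_poset C a"]
        poset_hom_comp[OF poset_hom_ten[OF poset_hom_unit poset_hom_id] poset_hom_pairing, of a]
      by (simp add: hom_poset_calc pairing_lunit)
    show "(Id Poset (ObMap (hom_unit C) a) \<otimes>\<^bsub>Poset\<^esub> hom_unit_laxator0 C)
          \<Zsemi>\<^bsub>Poset\<^esub> hom_unit_laxator C a (Unit C) \<Zsemi>\<^bsub>Poset\<^esub> ArrMap (hom_unit C) (RUnit C a)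
        = RUnit Poset (ObMap (hom_unit C) a)"
      unfolding hom_unit_ArrMap[OF runit_hom[OF ob]] rho rho0
      using poset_hom_ten[OF poset_hom_id poset_hom_unit, of "hom_poset C a"]
        poset_hom_comp[OF poset_hom_ten[OF poset_hom_id poset_hom_unit] poset_hom_pairing, of a]
      by (simp add: hom_poset_calc pairing_runit[OF _ LR])
  qed
qed

text \<open>Isolates what relations must supply. With \<open>e\<close> as discarding maps,
  \<open>diag\<close> is the unit inequality for projecting and pairing, while \<open>top\<close>
  yields the counit inequalities and the adjoint of the nullary laxator.\<close>

lemma ajax_hom_unit:
  assumes LR: "LUnit C (Unit C) = RUnit C (Unit C)"
    and S: "Swap C (Unit C) (Unit C) = Id C (Unit C \<odot> Unit C)"
    and top: "\<And>t. t \<in> hom C (Unit C) (Unit C) \<Longrightarrow> t \<sqsubseteq> Id C (Unit C)"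
    and e: "\<And>a. a \<in> Ob C \<Longrightarrow> e a \<in> hom C a (Unit C)"
    and diag: "\<And>a b x. a \<in> Ob C \<Longrightarrow> b \<in> Ob C \<Longrightarrow> x \<in> hom C (Unit C) (a \<odot> b) \<Longrightarrow>
      x \<sqsubseteq> unit_split \<Zsemi> ((x \<Zsemi> ((Id C a \<otimes> e b) \<Zsemi> RUnit C a)) \<otimes> (x \<Zsemi> ((e a \<otimes> Id C b) \<Zsemi> LUnit C b)))"
  shows "ajax C Poset (hom_unit C) (hom_unit_laxator0 C) (hom_unit_laxator C)"
proof -
  interpret lax_sym_mon_pofunctor C Poset "hom_unit C" "hom_unit_laxator0 C" "hom_unit_laxator C"
    by (rule lax_sym_mon_pofunctor_hom_unit[OF LR S])
  show ?thesis
  proof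
    \<comment> \<open>The left adjoint is the map to the one-point poset; its unit inequality says
      that the identity is the top element.\<close>
    have "left_adjoint Poset (poset_map (hom_poset C (Unit C)) (\<lambda>_. Star) unit_poset) (hom_unit_laxator0 C)"
      unfolding hom_unit_laxator0_def
      using poset_hom_unit top id_hom[OF unit_ob]
      by (intro poset_left_adjoint)
        (auto simp: Partial_orders Partial_order_hom_poset mem_Field_hom_poset mem_Field_unit_poset
          poset_hom_def Star_unit_poset)
    then show "is_right_adjoint Poset (hom_unit_laxator0 C)"
      unfolding is_right_adjoint_def by blast
  next
    fix a b assume ob: "a \<in> Ob C" "b \<in> Ob C"
    define p where "p = (Id C a \<otimes> e b) \<Zsemi> RUnit C a"
    define q where "q = (e a \<otimes> Id C b) \<Zsemi> LUnit C b"
    have p: "p \<in> hom C (a \<odot> b) a"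
      using comp_hom[OF ten_hom[OF id_hom[OF ob(1)] e[OF ob(2)]] runit_hom[OF ob(1)]] by (simp add: p_def)
    have q: "q \<in> hom C (a \<odot> b) b"
      using comp_hom[OF ten_hom[OF e[OF ob(1)] id_hom[OF ob(2)]] lunit_hom[OF ob(2)]] by (simp add: q_def)
    have "left_adjoint Poset (poset_map (hom_poset C (a \<odot> b))
        (\<lambda>x. Couple (Atom (unAtom x \<Zsemi> p)) (Atom (unAtom x \<Zsemi> q)))
        (prod_poset (hom_poset C a) (hom_poset C b))) (hom_unit_laxator C a b)"
      unfolding hom_unit_laxator_def
    proof (intro poset_left_adjoint Partial_order_hom_poset Partial_orders poset_hom_pairing)
      show "poset_hom (hom_poset C (a \<odot> b)) (prod_poset (hom_poset C a) (hom_poset C b))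
          (\<lambda>x. Couple (Atom (unAtom x \<Zsemi> p)) (Atom (unAtom x \<Zsemi> q)))"
        using poset_hom_post_comp[OF p] poset_hom_post_comp[OF q]
        by (simp add: poset_hom_def Couple_prod_poset_iff)
    next
      fix x assume "x \<in> Field (hom_poset C (a \<odot> b))"
      then obtain f where x: "x = Atom f" and f: "f \<in> hom C (Unit C) (a \<odot> b)"
        by (auto simp: mem_Field_hom_poset)
      show "(x, Atom (unit_split \<Zsemi>
              (unAtom (left (Couple (Atom (unAtom x \<Zsemi> p)) (Atom (unAtom x \<Zsemi> q)))) \<otimes>
               unAtom (right (Couple (Atom (unAtom x \<Zsemi> p)) (Atom (unAtom x \<Zsemi> q)))))))
            \<in> hom_poset C (a \<odot> b)"
        using pairing_hom[OF comp_hom[OF f p] comp_hom[OF f q]] f diag[OF ob f, folded p_def q_def]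
        by (simp add: x)
    next
      fix y assume "y \<in> Field (prod_poset (hom_poset C a) (hom_poset C b))"
      then obtain f g where y: "y = Couple (Atom f) (Atom g)"
        and fg: "f \<in> hom C (Unit C) a" "g \<in> hom C (Unit C) b"
        by (auto simp: mem_Field_hom_poset mem_Field_prod_poset Partial_order_hom_poset)
      show "(Couple (Atom (unAtom (Atom (unit_split \<Zsemi> (unAtom (left y) \<otimes> unAtom (right y)))) \<Zsemi> p))
               (Atom (unAtom (Atom (unit_split \<Zsemi> (unAtom (left y) \<otimes> unAtom (right y)))) \<Zsemi> q)), y)
            \<in> prod_poset (hom_poset C a) (hom_poset C b)"
        using pairing_discard_right[OF top LR fg e[OF ob(2)], folded p_def]
          pairing_discard_left[OF top fg e[OF ob(1)], folded q_def]
          comp_hom[OF pairing_hom[OF fg] p] comp_hom[OF pairing_hom[OF fg] q] fg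
        by (simp add: y Couple_prod_poset_iff)
    qed
    then show "is_right_adjoint Poset (hom_unit_laxator C a b)"
      unfolding is_right_adjoint_def by blast
  qed
qed

end

section \<open>Transport along the isomorphism with relations\<close>

context regular_category_chosen_products
begin

section \<open>Relations out of the terminal object as subobjects\<close>

lemma rel_to_sub_image: "rel_to_sub C (u, S, r) = (\<lambda>k. k \<Zsemi> Pr2 C u r) ` S"
  by (auto simp: rel_to_sub_def)

text \<open>Two bijections are composed: forgetting the fixed endpoints leaves a subobject of
  \<open>One C \<boxtimes> r\<close>, and the second projection, an isomorphism, carries it to
  \<open>r\<close>.\<close>

lemma rel_to_sub_bij:
  assumes "r \<in> Ob C"
  shows "bij_betw (rel_to_sub C) (hom (Rel C) (One C) r) (Sub C r)"
proof -
  obtain j where j: "j \<in> hom C r (One C \<boxtimes> r)" "Pr2 C (One C) r \<Zsemi> j = Id C (One C \<boxtimes> r)"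
    "j \<Zsemi> Pr2 C (One C) r = Id C r"
    using assms by (rule Pr2_One_iso)
  have "bij_betw (\<lambda>X. fst (snd X)) (hom (Rel C) (One C) r) (Sub C (One C \<boxtimes> r))"
    using assms One_ob
    by (intro bij_betw_byWitness[where f' = "\<lambda>S. (One C, S, r)"]) (auto simp: hom_Rel)
  from bij_betw_trans[OF this post_comp_iso_bij_Sub[OF Pr_hom(2)[OF One_ob assms] j]]
  have "bij_betw (image (\<lambda>k. k \<Zsemi> Pr2 C (One C) r) \<circ> (\<lambda>X. fst (snd X)))
    (hom (Rel C) (One C) r) (Sub C r)" .
  then show ?thesis
    by (rule bij_betw_cong[THEN iffD1, rotated]) (auto simp: hom_Rel rel_to_sub_image)
qed

lemma rel_to_sub_le:
  assumes "X \<in> hom (Rel C) (One C) r" "Y \<in> hom (Rel C) (One C) r"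
  shows "sub_le C (rel_to_sub C X) (rel_to_sub C Y) \<longleftrightarrow> X \<sqsubseteq>\<^bsub>Rel C\<^esub> Y"
proof -
  obtain S T where XY: "X = (One C, S, r)" "Y = (One C, T, r)" and r: "r \<in> Ob C"
    and ST: "S \<in> Sub C (One C \<boxtimes> r)" "T \<in> Sub C (One C \<boxtimes> r)"
    using assms by (auto simp: hom_Rel)
  obtain j where j: "j \<in> hom C r (One C \<boxtimes> r)" "Pr2 C (One C) r \<Zsemi> j = Id C (One C \<boxtimes> r)"
    using r by (rule Pr2_One_iso)
  show ?thesis
    unfolding XY rel_to_sub_image using post_comp_iso_sub_le[OF Pr_hom(2)[OF One_ob r] j ST] by simp
qed

text \<open>The leg \<open>m \<Zsemi> Pr2 C (One C) r\<close> pulled back in \<open>rel_comp\<close>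
  is exactly a member of \<open>rel_to_sub C X\<close>, so both sides are unions over the same
  choices. Their images correspond along the isomorphism from \<open>One C \<boxtimes> s\<close> to
  \<open>s\<close>.\<close>

lemma rel_to_sub_comp:
  assumes X: "X \<in> hom (Rel C) (One C) r" and F: "F \<in> hom (Rel C) r s"
  shows "rel_to_sub C (rel_comp C X F) = sub_push C F (rel_to_sub C X)"
proof -
  obtain S where XS: "X = (One C, S, r)" and r: "r \<in> Ob C"
    using X by (auto simp: hom_Rel)
  obtain T where FT: "F = (r, T, s)" and s: "s \<in> Ob C"
    using F by (auto simp: hom_Rel)
  obtain j where j: "j \<in> hom C s (One C \<boxtimes> s)" "Pr2 C (One C) s \<Zsemi> j = Id C (One C \<boxtimes> s)"
    "j \<Zsemi> Pr2 C (One C) s = Id C s"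
    using s by (rule Pr2_One_iso)
  have image: "(\<lambda>k. k \<Zsemi> Pr2 C (One C) s) `
      image_sub C (tuple C (p \<Zsemi> (m \<Zsemi> Pr1 C (One C) r)) (q \<Zsemi> (n \<Zsemi> Pr2 C r s)))
      = image_sub C (q \<Zsemi> (n \<Zsemi> Pr2 C r s))"
    if m: "m \<in> S" and n: "n \<in> T" and pb: "is_pullback C p q (m \<Zsemi> Pr2 C (One C) r) (n \<Zsemi> Pr1 C r s)"
    for m n p q
  proof -
    note mm = mem_hom_Rel[OF X[unfolded XS] m] and nn = mem_hom_Rel[OF F[unfolded FT] n]
    have "Dom C (m \<Zsemi> Pr2 C (One C) r) = Dom C m" "Dom C (n \<Zsemi> Pr1 C r s) = Dom C n"
      using mm(4) nn(3) by (simp_all add: hom_def)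
    then have p: "p \<in> hom C (Dom C p) (Dom C m)" and q: "q \<in> hom C (Dom C p) (Dom C n)"
      using pb by (simp_all add: is_pullback_def)
    note t = tuple[OF comp_hom[OF p mm(3)] comp_hom[OF q nn(4)]]
    show ?thesis
      using post_comp_iso_image_sub[OF t(1) Pr_hom(2)[OF One_ob s] j] t(3) by simp
  qed
  have "rel_to_sub C (rel_comp C X F) = \<Union>{(\<lambda>k. k \<Zsemi> Pr2 C (One C) s) `
      image_sub C (tuple C (p \<Zsemi> (m \<Zsemi> Pr1 C (One C) r)) (q \<Zsemi> (n \<Zsemi> Pr2 C r s))) | m n p q.
      m \<in> S \<and> n \<in> T \<and> is_pullback C p q (m \<Zsemi> Pr2 C (One C) r) (n \<Zsemi> Pr1 C r s)}"
    unfolding XS FT rel_comp_def prod.case rel_to_sub_image image_Union by (rule arg_cong[where f = Union]) blast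
  also have "\<dots> = \<Union>{image_sub C (q \<Zsemi> (n \<Zsemi> Pr2 C r s)) | m n p q.
      m \<in> S \<and> n \<in> T \<and> is_pullback C p q (m \<Zsemi> Pr2 C (One C) r) (n \<Zsemi> Pr1 C r s)}"
    by (rule arg_cong[where f = Union]) (use image in \<open>metis (no_types, lifting)\<close>)
  also have "\<dots> = sub_push C F (rel_to_sub C X)"
    unfolding XS FT sub_push_def prod.case rel_to_sub_image by (rule arg_cong[where f = Union]) blast
  finally show ?thesis .
qed

end

text \<open>Categorical and monoidal laws are taken from \<open>R\<close> and carried across \<Phi>,
  while \<open>C\<close> supplies the generalized elements. This avoids proving those laws for
  \<open>Rel C\<close> by calculations with subobjects.\<close>

locale rel_presentation =
  regular_category_chosen_products C + R: sym_mon_pocat R + sym_mon_po_iso R "Rel C" \<Phi>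
  for C :: "('o, 'a, 'z) fpcat_scheme" (structure)
    and R :: "('p, 'b, 'y) smpocat_scheme"
    and \<Phi> :: "('p, 'b, 'o, ('o, 'a) rel_arr) pofun"
begin

section \<open>Arrows of \<open>R\<close> tested on generalized elements\<close>

abbreviation holds :: "'b \<Rightarrow> 'a \<Rightarrow> 'a \<Rightarrow> bool" where
  "holds x \<equiv> rel_holds C (ArrMap \<Phi> x)"

lemma Phi_ob: "a \<in> Ob R \<Longrightarrow> ObMap \<Phi> a \<in> Ob C"
  using fun_ob by simp

text \<open>Bijectivity on all arrows does not by itself respect hom-sets: the endpoints of a
  preimage are determined by injectivity on objects.\<close>

lemma Phi_hom_bij:
  assumes "a \<in> Ob R" "b \<in> Ob R"
  shows "bij_betw (ArrMap \<Phi>) (hom R a b) (hom (Rel C) (ObMap \<Phi> a) (ObMap \<Phi> b))"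
  unfolding bij_betw_def
proof
  show "inj_on (ArrMap \<Phi>) (hom R a b)"
    using arr_bij by (rule inj_on_subset[OF bij_betw_imp_inj_on]) (auto simp: hom_def)
  show "ArrMap \<Phi> ` hom R a b = hom (Rel C) (ObMap \<Phi> a) (ObMap \<Phi> b)"
  proof
    show "ArrMap \<Phi> ` hom R a b \<subseteq> hom (Rel C) (ObMap \<Phi> a) (ObMap \<Phi> b)"
      using fun_hom by blast
    show "hom (Rel C) (ObMap \<Phi> a) (ObMap \<Phi> b) \<subseteq> ArrMap \<Phi> ` hom R a b"
    proof
      fix X assume X: "X \<in> hom (Rel C) (ObMap \<Phi> a) (ObMap \<Phi> b)"
      then have "X \<in> ArrMap \<Phi> ` Arr R"
        using bij_betw_imp_surj_on[OF arr_bij] by (simp add: hom_def)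
      then obtain x where x: "x \<in> Arr R" "ArrMap \<Phi> x = X" by auto
      have "X \<in> hom (Rel C) (ObMap \<Phi> (Dom R x)) (ObMap \<Phi> (Cod R x))"
        using fun_hom[of x] x by (simp add: hom_def)
      then have "ObMap \<Phi> (Dom R x) = ObMap \<Phi> a" "ObMap \<Phi> (Cod R x) = ObMap \<Phi> b"
        using X by (simp_all add: hom_def)
      then have "Dom R x = a" "Cod R x = b"
        using bij_betw_imp_inj_on[OF ob_bij] assms R.dom_ob[OF x(1)] R.cod_ob[OF x(1)]
        by (simp_all add: inj_on_def)
      then show "X \<in> ArrMap \<Phi> ` hom R a b" using x by (auto simp: hom_def)
    qed
  qed
qed

lemma graph_lift:
  assumes "a \<in> Ob R" "b \<in> Ob R" "f \<in> hom C (ObMap \<Phi> a) (ObMap \<Phi> b)"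
  obtains x where "x \<in> hom R a b" "ArrMap \<Phi> x = graph C f"
  using bij_betw_imp_surj_on[OF Phi_hom_bij[OF assms(1,2)]] graph_hom[OF assms(3)] that
  by (metis imageE)

text \<open>The composite is a relation, as \<open>rel_holds_comp\<close> requires, because it is
  the image under \<Phi> of an arrow of \<open>R\<close>.\<close>

lemma holds_comp:
  assumes "x \<in> hom R a b" "y \<in> hom R b c" "holds x f g" "holds y g k"
  shows "holds (x \<Zsemi>\<^bsub>R\<^esub> y) f k"
  using rel_holds_comp[OF fun_hom[OF assms(1)] fun_hom[OF assms(2)] _ assms(3,4)]
    fun_hom[OF R.comp_hom[OF assms(1,2)]] fun_comp[OF assms(1,2)] by simp

lemma holds_ten:
  assumes "x \<in> hom R a b" "y \<in> hom R c d" "holds x f g" "holds y f' g'" "Dom C f = Dom C f'"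
  shows "holds (x \<otimes>\<^bsub>R\<^esub> y) (tuple C f f') (tuple C g g')"
proof -
  have ob: "a \<in> Ob R" "b \<in> Ob R" "c \<in> Ob R" "d \<in> Ob R"
    using R.hom_ob assms by auto
  have "ArrMap \<Phi> (x \<otimes>\<^bsub>R\<^esub> y) = rel_ten C (ArrMap \<Phi> x) (ArrMap \<Phi> y)"
    using iso_tenA[of x y] assms(1,2) by (simp add: hom_def)
  then show ?thesis
    using rel_holds_ten[OF fun_hom[OF assms(1)] fun_hom[OF assms(2)] _ assms(3-5)]
      fun_hom[OF R.ten_hom[OF assms(1,2)]] iso_tenO ob by simp
qed

lemma holds_id:
  assumes "a \<in> Ob R" "f \<in> hom C x (ObMap \<Phi> a)"
  shows "holds (Id R a) f f"
  using rel_holds_graph[OF id_hom[OF Phi_ob[OF assms(1)]] assms(2)] id_right[OF assms(2)] fun_id[OF assms(1)]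
  by simp

lemma leq_if_holds:
  assumes "x \<in> hom R a b" "y \<in> hom R a b" "\<And>f g. holds x f g \<Longrightarrow> holds y f g"
  shows "x \<sqsubseteq>\<^bsub>R\<^esub> y"
  using reflects_leq[OF assms(1,2)] Rel_leqI[OF fun_hom[OF assms(1)] fun_hom[OF assms(2)] assms(3)]
  by blast

section \<open>Structure at the unit object, deduced from terminality\<close>

lemma unit_Phi: "ObMap \<Phi> (Unit R) = One C"
  using iso_unit by simp

text \<open>Parallel maps into the terminal object are equal, so every related pair has the form
  \<open>(f, f)\<close>, and the identity relates all of these.\<close>

lemma leq_Id_unit:
  assumes "t \<in> hom R (Unit R) (Unit R)"
  shows "t \<sqsubseteq>\<^bsub>R\<^esub> Id R (Unit R)"
proof (rule leq_if_holds[OF assms R.id_hom[OF R.unit_ob]])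
  fix f g assume fg: "holds t f g"
  have *: "f \<in> hom C (Dom C f) (One C)" "g \<in> hom C (Dom C f) (One C)"
    using rel_holds_hom[OF fun_hom[OF assms] fg] by (simp_all add: unit_Phi)
  then have "g = f" using One_unique by blast
  then show "holds (Id R (Unit R)) f g"
    using holds_id[OF R.unit_ob] *(1) unit_Phi by simp
qed

text \<open>The two projections of \<open>One C \<boxtimes> One C\<close> agree by terminality, and
  \<Phi> is injective on hom-sets.\<close>

lemma LUnit_unit_eq: "LUnit R (Unit R) = RUnit R (Unit R)"
proof -
  have ob: "Unit R \<odot>\<^bsub>R\<^esub> Unit R \<in> Ob R" using R.ten_ob R.unit_ob by simp
  have "Pr2 C (One C) (One C) = Pr1 C (One C) (One C)"
    using One_unique Pr_hom[OF One_ob One_ob] by blast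
  then have "ArrMap \<Phi> (LUnit R (Unit R)) = ArrMap \<Phi> (RUnit R (Unit R))"
    using iso_lunit[OF R.unit_ob] iso_runit[OF R.unit_ob] unit_Phi by simp
  then show ?thesis
    using bij_betw_imp_inj_on[OF Phi_hom_bij[OF ob R.unit_ob]] R.lunit_hom[OF R.unit_ob]
      R.runit_hom[OF R.unit_ob] by (meson inj_onD)
qed

lemma Swap_unit: "Swap R (Unit R) (Unit R) = Id R (Unit R \<odot>\<^bsub>R\<^esub> Unit R)"
proof -
  have ob: "Unit R \<odot>\<^bsub>R\<^esub> Unit R \<in> Ob R" using R.ten_ob R.unit_ob by simp
  have I: "One C \<boxtimes> One C \<in> Ob C" using hom_ob Pr_hom[OF One_ob One_ob] by blast
  have "Pr2 C (One C) (One C) = Pr1 C (One C) (One C)"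
    using One_unique Pr_hom[OF One_ob One_ob] by blast
  then have "tuple C (Pr2 C (One C) (One C)) (Pr1 C (One C) (One C)) = Id C (One C \<boxtimes> One C)"
    by (intro tuple_eqI[symmetric, OF id_hom[OF I] One_ob One_ob])
      (simp_all add: id_left[OF Pr_hom(1)[OF One_ob One_ob]])
  then have "ArrMap \<Phi> (Swap R (Unit R) (Unit R)) = ArrMap \<Phi> (Id R (Unit R \<odot>\<^bsub>R\<^esub> Unit R))"
    using iso_swap[OF R.unit_ob R.unit_ob] fun_id[OF ob] iso_tenO[OF R.unit_ob R.unit_ob] unit_Phi by simp
  then show ?thesis
    using bij_betw_imp_inj_on[OF Phi_hom_bij[OF ob ob]] R.swap_hom[OF R.unit_ob R.unit_ob]
      R.id_hom[OF ob] by (meson inj_onD)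
qed

text \<open>Each clause joins a property of \<Phi> (bijective on hom-sets, preserving and reflecting
  the order, functorial) to the matching fact about \<open>rel_to_sub\<close>.\<close>

lemma hom_unit_is_Sub: "hom_unit_is_Sub C R \<Phi>"
  unfolding hom_unit_is_Sub_def
proof (intro conjI ballI allI impI)
  fix r assume r: "r \<in> Ob R"
  show "bij_betw (\<lambda>x. rel_to_sub C (ArrMap \<Phi> x)) (hom R (Unit R) r) (Sub C (ObMap \<Phi> r))"
    using bij_betw_trans[OF Phi_hom_bij[OF R.unit_ob r, unfolded unit_Phi] rel_to_sub_bij[OF Phi_ob[OF r]]]
    by (simp add: comp_def)
  fix x y assume x: "x \<in> hom R (Unit R) r" and y: "y \<in> hom R (Unit R) r"
  have "x \<sqsubseteq>\<^bsub>R\<^esub> y \<longleftrightarrow> ArrMap \<Phi> x \<sqsubseteq>\<^bsub>Rel C\<^esub> ArrMap \<Phi> y"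
    using fun_mono[OF x y] reflects_leq[OF x y] by blast
  then show "x \<sqsubseteq>\<^bsub>R\<^esub> y \<longleftrightarrow> sub_le C (rel_to_sub C (ArrMap \<Phi> x)) (rel_to_sub C (ArrMap \<Phi> y))"
    using rel_to_sub_le[of "ArrMap \<Phi> x" "ObMap \<Phi> r" "ArrMap \<Phi> y"] fun_hom[OF x] fun_hom[OF y]
    by (simp add: unit_Phi)
next
  fix r s f x assume *: "f \<in> hom R r s \<and> x \<in> hom R (Unit R) r"
  then have f: "f \<in> hom R r s" and x: "x \<in> hom R (Unit R) r" by auto
  show "rel_to_sub C (ArrMap \<Phi> (x \<Zsemi>\<^bsub>R\<^esub> f)) = sub_push C (ArrMap \<Phi> f) (rel_to_sub C (ArrMap \<Phi> x))"
    using rel_to_sub_comp[OF fun_hom[OF x, unfolded unit_Phi] fun_hom[OF f]] fun_comp[OF x f] by simp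
qed

text \<open>The inverse unitor contains the graph of the diagonal of the terminal object; the unit
  inequality for the binary laxator duplicates its source element by this fact.\<close>

lemma holds_unit_split:
  assumes "f \<in> hom C x (One C)"
  shows "holds (inverse_arr R (LUnit R (Unit R))) f (tuple C f f)"
proof -
  let ?l = "LUnit R (Unit R)" and ?u = "inverse_arr R (LUnit R (Unit R))"
  have I: "Unit R \<in> Ob R" and II: "Unit R \<odot>\<^bsub>R\<^esub> Unit R \<in> Ob R" using R.ten_ob R.unit_ob by simp_all
  have II_Phi: "ObMap \<Phi> (Unit R \<odot>\<^bsub>R\<^esub> Unit R) = One C \<boxtimes> One C"
    using iso_tenO[OF I I] unit_Phi by simp
  \<comment> \<open>The diagonal of the terminal object, whose graph is lifted to the arrow
    \<open>v\<close> of \<open>R\<close>.\<close>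
  define d where "d = tuple C (Id C (One C)) (Id C (One C))"
  note i = id_hom[OF One_ob]
  note d = tuple[OF i i, folded d_def]
  obtain v where v: "v \<in> hom R (Unit R) (Unit R \<odot>\<^bsub>R\<^esub> Unit R)" "ArrMap \<Phi> v = graph C d"
    using graph_lift[OF I II, of d] d(1) unit_Phi II_Phi by metis
  note u = R.unit_split and l = R.lunit_hom[OF I]
  have vl: "v \<Zsemi>\<^bsub>R\<^esub> ?l \<in> hom R (Unit R) (Unit R)" by (rule R.comp_hom[OF v(1) l])
  \<comment> \<open>Comparing \<open>v\<close> with the inverse of \<open>?l\<close> suffices: it avoids computing that inverse in \<open>Rel C\<close>.\<close>
  have "v = v \<Zsemi>\<^bsub>R\<^esub> ?l \<Zsemi>\<^bsub>R\<^esub> ?u"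
    using R.comp_assoc[OF v(1) l u(1)] u(2) R.id_right[OF v(1)] by simp
  also have "\<dots> \<sqsubseteq>\<^bsub>R\<^esub> Id R (Unit R) \<Zsemi>\<^bsub>R\<^esub> ?u"
    by (rule R.comp_mono[OF vl R.id_hom[OF I] u(1) u(1) leq_Id_unit[OF vl] R.leq_refl[OF u(1)]])
  finally have "v \<sqsubseteq>\<^bsub>R\<^esub> ?u" using R.id_left[OF u(1)] by simp
  then have "ArrMap \<Phi> v \<sqsubseteq>\<^bsub>Rel C\<^esub> ArrMap \<Phi> ?u" by (rule fun_mono[OF v(1) u(1)])
  moreover have "holds v f (tuple C f f)"
    using rel_holds_graph[OF d(1) assms] comp_tuple[OF assms i i] id_right[OF assms]
    by (simp add: v(2) d_def)
  ultimately show ?thesis by (rule rel_holds_mono[OF fun_hom[OF v(1)] fun_hom[OF u(1)]])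
qed

lemma ajax_hom_unit_Rel: "ajax R Poset (hom_unit R) (hom_unit_laxator0 R) (hom_unit_laxator R)"
proof -
  \<comment> \<open>The discarding arrow of \<open>a\<close> is the lifted graph of the map to the
    terminal object. The existential form allows arrows and maps to be chosen as functions of
    \<open>a\<close>.\<close>
  have "\<exists>x f. x \<in> hom R a (Unit R) \<and> f \<in> hom C (ObMap \<Phi> a) (One C) \<and> ArrMap \<Phi> x = graph C f"
    if a: "a \<in> Ob R" for a
  proof -
    obtain f where f: "f \<in> hom C (ObMap \<Phi> a) (One C)" using One_arrow[OF Phi_ob[OF a]] by blast
    show ?thesis using graph_lift[OF a R.unit_ob, of f] f unit_Phi by metis
  qed
  then obtain e t where e: "\<And>a. a \<in> Ob R \<Longrightarrow> e a \<in> hom R a (Unit R)"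
    and t: "\<And>a. a \<in> Ob R \<Longrightarrow> t a \<in> hom C (ObMap \<Phi> a) (One C)"
    and et: "\<And>a. a \<in> Ob R \<Longrightarrow> ArrMap \<Phi> (e a) = graph C (t a)"
    by metis
  \<comment> \<open>By terminality \<open>g\<close> equals \<open>f \<Zsemi> t a\<close>, the value
    that the graph relates to \<open>f\<close>.\<close>
  have holds_e: "holds (e a) f g" if "a \<in> Ob R" "f \<in> hom C x (ObMap \<Phi> a)" "g \<in> hom C x (One C)"
    for a f g x
    using rel_holds_graph[OF t that(2)] One_unique[OF comp_hom[OF that(2) t] that(3)] et that(1) by simp
  show ?thesis
  proof (rule R.ajax_hom_unit[OF LUnit_unit_eq Swap_unit leq_Id_unit e])
    fix a b x assume a: "a \<in> Ob R" and b: "b \<in> Ob R" and x: "x \<in> hom R (Unit R) (a \<odot>\<^bsub>R\<^esub> b)"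
    let ?p = "(Id R a \<otimes>\<^bsub>R\<^esub> e b) \<Zsemi>\<^bsub>R\<^esub> RUnit R a" and ?q = "(e a \<otimes>\<^bsub>R\<^esub> Id R b) \<Zsemi>\<^bsub>R\<^esub> LUnit R b"
    have ie: "Id R a \<otimes>\<^bsub>R\<^esub> e b \<in> hom R (a \<odot>\<^bsub>R\<^esub> b) (a \<odot>\<^bsub>R\<^esub> Unit R)"
      and ei: "e a \<otimes>\<^bsub>R\<^esub> Id R b \<in> hom R (a \<odot>\<^bsub>R\<^esub> b) (Unit R \<odot>\<^bsub>R\<^esub> b)"
      using R.ten_hom R.id_hom e a b by blast+
    have p: "?p \<in> hom R (a \<odot>\<^bsub>R\<^esub> b) a" and q: "?q \<in> hom R (a \<odot>\<^bsub>R\<^esub> b) b"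
      using R.comp_hom[OF ie R.runit_hom[OF a]] R.comp_hom[OF ei R.lunit_hom[OF b]] by blast+
    note xp = R.comp_hom[OF x p] and xq = R.comp_hom[OF x q]
    note ob = Phi_ob[OF a] Phi_ob[OF b] and u = R.unit_split(1)
    show "x \<sqsubseteq>\<^bsub>R\<^esub> inverse_arr R (LUnit R (Unit R)) \<Zsemi>\<^bsub>R\<^esub> ((x \<Zsemi>\<^bsub>R\<^esub> ?p) \<otimes>\<^bsub>R\<^esub> (x \<Zsemi>\<^bsub>R\<^esub> ?q))"
    proof (rule leq_if_holds[OF x R.pairing_hom[OF xp xq]])
      fix f g assume fg: "holds x f g"
      \<comment> \<open>The route from \<open>f\<close> to \<open>g\<close> on the right side: the
        inverse unitor doubles \<open>f\<close> to \<open>(f, f)\<close>, then \<open>x\<close>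
        followed by \<open>?p\<close> or \<open>?q\<close> relates the two copies to the components
        \<open>g1\<close> and \<open>g2\<close>.\<close>
      define g1 where "g1 = g \<Zsemi> Pr1 C (ObMap \<Phi> a) (ObMap \<Phi> b)"
      define g2 where "g2 = g \<Zsemi> Pr2 C (ObMap \<Phi> a) (ObMap \<Phi> b)"
      have f: "f \<in> hom C (Dom C f) (One C)" and g: "g \<in> hom C (Dom C f) (ObMap \<Phi> a \<boxtimes> ObMap \<Phi> b)"
        using rel_holds_hom[OF fun_hom[OF x] fg] iso_tenO[OF a b] by (simp_all add: unit_Phi)
      have g1: "g1 \<in> hom C (Dom C f) (ObMap \<Phi> a)" and g2: "g2 \<in> hom C (Dom C f) (ObMap \<Phi> b)"
        using comp_hom[OF g Pr_hom(1)[OF ob]] comp_hom[OF g Pr_hom(2)[OF ob]]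
        by (simp_all add: g1_def g2_def)
      have d: "Dom C g1 = Dom C g2" using g1 g2 by (simp add: hom_def)
      have g_eq: "g = tuple C g1 g2" by (rule tuple_eqI[OF g ob]) (simp_all add: g1_def g2_def)
      \<comment> \<open>Discarding \<open>b\<close> turns \<open>(g1, g2)\<close> into
        \<open>(g1, f)\<close>, where \<open>f\<close> serves as the map into the terminal object;
        the unitor then drops it.\<close>
      have "holds (RUnit R a) (tuple C g1 f) g1"
        using rel_holds_graph[OF Pr_hom(1)[OF ob(1) One_ob] tuple(1)[OF g1 f]] tuple(2)[OF g1 f]
          iso_runit[OF a] by simp
      then have "holds ?p g g1"
        using holds_comp[OF ie R.runit_hom[OF a]]
          holds_ten[OF R.id_hom[OF a] e[OF b] holds_id[OF a g1] holds_e[OF b g2 f] d] g_eq by simp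
      then have hp: "holds (x \<Zsemi>\<^bsub>R\<^esub> ?p) f g1" by (rule holds_comp[OF x p fg])
      have "holds (LUnit R b) (tuple C f g2) g2"
        using rel_holds_graph[OF Pr_hom(2)[OF One_ob ob(2)] tuple(1)[OF f g2]] tuple(3)[OF f g2]
          iso_lunit[OF b] by simp
      then have "holds ?q g g2"
        using holds_comp[OF ei R.lunit_hom[OF b]]
          holds_ten[OF e[OF a] R.id_hom[OF b] holds_e[OF a g1 f] holds_id[OF b g2] d] g_eq by simp
      then have hq: "holds (x \<Zsemi>\<^bsub>R\<^esub> ?q) f g2" by (rule holds_comp[OF x q fg])
      show "holds (inverse_arr R (LUnit R (Unit R)) \<Zsemi>\<^bsub>R\<^esub> ((x \<Zsemi>\<^bsub>R\<^esub> ?p) \<otimes>\<^bsub>R\<^esub> (x \<Zsemi>\<^bsub>R\<^esub> ?q))) f g"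
        using holds_comp[OF u R.ten_hom[OF xp xq] holds_unit_split[OF f] holds_ten[OF xp xq hp hq refl]]
          g_eq by simp
    qed
  qed
qed

end

theorem theorem3p16:
  fixes C :: "('o, 'a, 'z) fpcat_scheme"
    and R :: "('p, 'b, 'y) smpocat_scheme"
    and \<Phi> :: "('p, 'b, 'o, ('o, 'a) rel_arr) pofun"
  assumes "regular_category_chosen_products C"
    and "sym_mon_pocat R"
    and "sym_mon_po_iso R (Rel C) \<Phi>"
  shows "hom_unit_is_Sub C R \<Phi> \<and>
    ajax R Poset (hom_unit R) (hom_unit_laxator0 R) (hom_unit_laxator R)"
proof -
  interpret rel_presentation C R \<Phi>
    using assms by (simp add: rel_presentation_def)
  show ?thesis using hom_unit_is_Sub ajax_hom_unit_Rel by simp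
qed

end
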